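(* Let $\mathfrak{M}=(M^{(x)})_{x>0}$ and $\mathfrak{N}=(N^{(x)})_{x>0}$ be weight matrices that are ordered with respect to their quotient sequences, i.e., $\mu^{(x)}\le \mu^{(y)}$ and $\nu^{(x)}\le \nu^{(y)}$ (pointwise) whenever $x\le y$, where $\mu^{(x)}_k=M^{(x)}_k/M^{(x)}_{k-1}$ and $\nu^{(x)}_k=N^{(x)}_k/N^{(x)}_{k-1}$ for $k\ge 1$. Then $$\Lambda^{(\mathfrak{M})}\subseteq j^\infty_0\,\mathcal{E}^{(\mathfrak{N})}(\mathbb{R})\quad\Longleftrightarrow\quad \forall y>0\ \exists x>0:\ M^{(x)}\prec_{SV}N^{(y)}.$$
   Context: $\mathbb{N}=\{0,1,2,\dots\}$. A weight sequence is a sequence $M=(M_k)_{k\in\mathbb{N}}$ of positive reals with $M_0=1$ and $M_k=\mu_1\cdots\mu_k$ for $k\ge1$, where $0<\mu_1\le\mu_2\le\cdots$ is an increasing (non-decreasing) sequence tending to $\infty$. A weight matrix is a one-parameter family $\mathfrak{M}=(M^{(x)})_{x>0}$ of weight sequences such that $M^{(x)}_k\le M^{(y)}_k$ for all $k$ if $x\le y$, and, for every $x>0$, $(M^{(x)}_j/j!)^{1/j}\to\infty$ as $j\to\infty$. For a weight matrix $\mathfrak{M}$ put $$\mathcal{E}^{(\mathfrak{M})}(\mathbb{R})=\Big\{f\in C^\infty(\mathbb{R}): \forall K\subset\mathbb{R}\text{ compact }\forall r,x>0:\ \sup_{t\in K,\,k\in\mathbb{N}}\frac{|f^{(k)}(t)|}{r^kM^{(x)}_k}<\infty\Big\},$$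 $$\Lambda^{(\mathfrak{M})}=\Big\{\lambda=(\lambda_k)_k\in\mathbb{C}^{\mathbb{N}}:\forall r,x>0:\ \sup_{k\in\mathbb{N}}\frac{|\lambda_k|}{r^kM^{(x)}_k}<\infty\Big\}.$$ Functions are complex-valued. The Borel map is $j^\infty_0 f=(f^{(n)}(0))_{n\in\mathbb{N}}$. For weight sequences $M,N$, $M\prec_{SV}N$ means: there exist $C,s\in\mathbb{N}_{\ge1}$ such that $$\sup_{j\ge1}\ \sup_{0\le i<j}\Big(\frac{M_j}{s^jN_i}\Big)^{\frac1{j-i}}\frac1j\sum_{k=j}^\infty\frac{N_{k-1}}{N_k}\le C.$$ *)

theory Defs
  imports "HOL-Analysis.Analysis"
begin

definition weight_sequence :: "(nat \<Rightarrow> real) \<Rightarrow> bool" where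
  "weight_sequence M \<longleftrightarrow> M 0 = 1 \<and>
    (\<exists>\<mu> :: nat \<Rightarrow> real.
      0 < \<mu> 1 \<and> (\<forall>k\<ge>1. \<mu> k \<le> \<mu> (Suc k)) \<and>
      filterlim \<mu> at_top sequentially \<and>
      (\<forall>k\<ge>1. M k = (\<Prod>i=1..k. \<mu> i)))"

text \<open>A weight matrix is indexed by the positive reals; the values of \<open>\<MM>\<close> at
  non-positive indices are irrelevant.\<close>

definition weight_matrix :: "(real \<Rightarrow> nat \<Rightarrow> real) \<Rightarrow> bool" where
  "weight_matrix \<MM> \<longleftrightarrow>
    (\<forall>x>0. weight_sequence (\<MM> x)) \<and>
    (\<forall>x y. 0 < x \<and> x \<le> y \<longrightarrow> (\<forall>k. \<MM> x k \<le> \<MM> y k)) \<and>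
    (\<forall>x>0. filterlim (\<lambda>j. (\<MM> x j / fact j) powr (1 / real j)) at_top sequentially)"

text \<open>Only the values at \<open>k \<ge> 1\<close> are meaningful, because of truncated subtraction.\<close>

definition quotient_seq :: "(nat \<Rightarrow> real) \<Rightarrow> nat \<Rightarrow> real" where
  "quotient_seq M k = M k / M (k - 1)"

definition quotient_ordered :: "(real \<Rightarrow> nat \<Rightarrow> real) \<Rightarrow> bool" where
  "quotient_ordered \<MM> \<longleftrightarrow>
    (\<forall>x y. 0 < x \<and> x \<le> y \<longrightarrow> (\<forall>k\<ge>1. quotient_seq (\<MM> x) k \<le> quotient_seq (\<MM> y) k))"

definition nth_deriv :: "nat \<Rightarrow> (real \<Rightarrow> complex) \<Rightarrow> real \<Rightarrow> complex" where
  "nth_deriv k f = ((\<lambda>g t. vector_derivative g (at t)) ^^ k) f"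

text \<open>\<open>vector_derivative\<close> is a total function with an arbitrary value where no derivative
  exists; \<open>nth_deriv k f\<close> is the genuine derivative because each lower one is required to
  be differentiable everywhere.\<close>

definition smooth :: "(real \<Rightarrow> complex) \<Rightarrow> bool" where
  "smooth f \<longleftrightarrow> (\<forall>k t. nth_deriv k f differentiable (at t))"

definition Beurling_functions :: "(real \<Rightarrow> nat \<Rightarrow> real) \<Rightarrow> (real \<Rightarrow> complex) set" where
  "Beurling_functions \<MM> = {f. smooth f \<and>
    (\<forall>K. compact K \<longrightarrow> (\<forall>r>0. \<forall>x>0.
      bdd_above ((\<lambda>(t, k). norm (nth_deriv k f t) / (r ^ k * \<MM> x k)) ` (K \<times> UNIV))))}"

definition Beurling_sequences :: "(real \<Rightarrow> nat \<Rightarrow> real) \<Rightarrow> (nat \<Rightarrow> complex) set" where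
  "Beurling_sequences \<MM> = {a. \<forall>r>0. \<forall>x>0.
    bdd_above (range (\<lambda>k. norm (a k) / (r ^ k * \<MM> x k)))}"

definition borel_map :: "(real \<Rightarrow> complex) \<Rightarrow> nat \<Rightarrow> complex" where
  "borel_map f = (\<lambda>n. nth_deriv n f 0)"

text \<open>The suprema and the series are taken in \<open>[0, \<infinity>]\<close>, so that the condition fails if the
  series diverges. The summation index is shifted: \<open>j + k\<close> runs through the integers
  \<open>\<ge> j\<close>.\<close>

definition prec_SV :: "(nat \<Rightarrow> real) \<Rightarrow> (nat \<Rightarrow> real) \<Rightarrow> bool"  (infix "\<prec>\<^sub>S\<^sub>V" 50) where
  "M \<prec>\<^sub>S\<^sub>V N \<longleftrightarrow> (\<exists>C s :: nat. C \<ge> 1 \<and> s \<ge> 1 \<and>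
    (SUP j\<in>{1..}. SUP i\<in>{0..<j}.
        ennreal ((M j / (real s ^ j * N i)) powr (1 / real (j - i))) * ennreal (1 / real j) *
        (\<Sum>k. ennreal (N (j + k - 1) / N (j + k))))
      \<le> ennreal (real C))"

end

theory Submission
  imports Defs
begin

text \<open>
  Both implications are proved by elementary means and without functional analysis. Write
  \<open>\<nu>\<^sub>k\<close> for the quotients of a weight sequence \<open>N\<close> and \<open>S\<^sub>j\<close> for the tail
  \<open>\<Sum>k\<ge>j. 1 / \<nu>\<^sub>k\<close>. The relation \<open>M \<prec>\<^sub>S\<^sub>V N\<close> says that the tails are finite and that
  \<open>M\<^sub>j (S\<^sub>j / j)\<^bsup>j-i\<^esup> \<le> C\<^bsup>j-i\<^esup> s\<^sup>j N\<^sub>i\<close> for \<open>i < j\<close> (\<open>prec_SV_iff\<close>).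

  Necessity. Bang's estimate (\<open>bang_estimate\<close>) says that a function whose derivatives are
  bounded by \<open>N\<^sub>k\<close> and which is flat at \<open>0\<close> stays tiny, of size \<open>e\<^sup>k\<^sup>-\<^sup>j N\<^sub>k\<close>, up to a
  distance comparable to the sum of the \<open>1 / \<nu>\<^sub>l\<close> with \<open>l > j\<close>. Hence, if the jet of \<open>f\<close> at
  \<open>0\<close> is nonnegative and has a long gap after the index \<open>j\<close>, then \<open>f\<close> is close to its Taylor
  polynomial of degree \<open>j\<close> up to that distance \<open>h\<close>. As no cancellation occurs in this
  polynomial, its single terms \<open>a\<^sub>j h\<^bsup>j-i\<^esup> / (j-i)!\<close> are bounded by \<open>4 C N\<^sub>i\<close>
  (\<open>taylor_coefficient_bound\<close>). If \<open>M\<^bsup>(x)\<^esup> \<prec>\<^sub>S\<^sub>V N\<^bsup>(y)\<^esup>\<close> fails for one \<open>y\<close> and all \<open>x\<close>,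
  then for every \<open>m\<close> there are arbitrarily large \<open>j\<close> at which the coefficient
  \<open>M\<^bsup>(x)\<^esup>\<^sub>j / s\<^sup>j\<close> with \<open>s = m + 1\<close> and \<open>x = 1 / s\<close> violates this bound with constant \<open>m\<close>.
  Collecting such coefficients at sufficiently lacunary indices gives one element of
  \<open>\<Lambda>\<^bsup>(\<MM>)\<^esup>\<close> that is not the jet of any function in the class (\<open>Beurling_inclusion_imp_prec_SV\<close>).
  The same argument with \<open>h = 1\<close> covers quasianalytic \<open>N\<close>, for which the tails diverge.

  Sufficiency. Let \<open>a \<in> \<Lambda>\<^bsup>(\<MM>)\<^esup>\<close>. A diagonal construction replaces the whole matrix \<open>\<NN>\<close> by a
  single sequence \<open>\<sigma>\<close> of quotients which lies eventually below all
  \<open>\<nu>\<^bsup>(1/(n+1))\<^esup> / (n+1)\<close>, while the numbers \<open>a\<^sub>j\<close> still satisfy the inequality of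
  \<open>prec_SV_iff\<close> with respect to \<open>\<sigma>\<close> (\<open>exists_diagonal_sequence\<close>). It then suffices to solve
  the problem with bounds of the form \<open>B 2\<^sup>k \<sigma>\<^sub>1 \<cdots> \<sigma>\<^sub>k\<close>. The function is
  \<open>a\<^sub>0 + \<Sum>j. a\<^sub>j \<chi>\<^sub>j(t) t\<^sup>j / j!\<close>, where \<open>\<chi>\<^sub>j\<close> is a cutoff at the scale of the
  tail \<open>S\<^sub>j\<close>, an infinite convolution of boxes (\<open>exists_cutoff\<close>). The widths of the boxes are
  tuned in such a way that the derivatives of \<open>\<chi>\<^sub>j\<close> of order \<open>i \<le> j\<close> grow at most like
  \<open>(j / S\<^sub>j)\<^sup>i\<close>, whereas products of the form \<open>\<sigma>\<^sub>j\<^sub>+\<^sub>1 \<sigma>\<^sub>j\<^sub>+\<^sub>2 \<cdots>\<close> are available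
  for derivatives of higher order (\<open>adapted_monomial_bound\<close>).
\<close>

section \<open>Towers of derivatives\<close>

text \<open>A function together with all its derivatives. Working with the whole family avoids iterated
  \<open>vector_derivative\<close> and turns each statement on higher derivatives into one on first ones.\<close>

definition derivative_tower :: "(nat \<Rightarrow> real \<Rightarrow> 'a::real_normed_vector) \<Rightarrow> bool" where
  "derivative_tower F \<longleftrightarrow> (\<forall>k t. (F k has_vector_derivative F (Suc k) t) (at t))"

lemma derivative_tower_real_iff:
  fixes F :: "nat \<Rightarrow> real \<Rightarrow> real"
  shows "derivative_tower F \<longleftrightarrow> (\<forall>k t. (F k has_real_derivative F (Suc k) t) (at t))"
  by (simp add: derivative_tower_def has_real_derivative_iff_has_vector_derivative)

lemma derivative_tower_nth_deriv:
  assumes "smooth f" shows "derivative_tower (\<lambda>k. nth_deriv k f)"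
  unfolding derivative_tower_def
proof (intro allI)
  fix k t
  have "(nth_deriv k f has_vector_derivative vector_derivative (nth_deriv k f) (at t)) (at t)"
    using assms by (simp add: smooth_def vector_derivative_works)
  then show "(nth_deriv k f has_vector_derivative nth_deriv (Suc k) f t) (at t)"
    by (simp add: nth_deriv_def)
qed

lemma nth_deriv_derivative_tower:
  assumes "derivative_tower F" shows "nth_deriv k (F 0) = F k"
proof (induction k)
  case 0 then show ?case by (simp add: nth_deriv_def)
next
  case (Suc k)
  have "nth_deriv (Suc k) (F 0) = (\<lambda>t. vector_derivative (nth_deriv k (F 0)) (at t))"
    by (simp add: nth_deriv_def)
  also have "\<dots> = F (Suc k)"
    using assms unfolding Suc derivative_tower_def by (auto intro: vector_derivative_at)
  finally show ?case .
qed

lemma smooth_derivative_tower: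
  assumes "derivative_tower F" shows "smooth (F 0)"
  unfolding smooth_def nth_deriv_derivative_tower[OF assms]
  using assms unfolding derivative_tower_def by (auto intro: differentiableI_vector)

lemma derivative_tower_diff:
  "derivative_tower F \<Longrightarrow> derivative_tower G \<Longrightarrow> derivative_tower (\<lambda>k t. F k t - G k t)"
  unfolding derivative_tower_def by (auto intro!: derivative_intros)

text \<open>Differentiation is local, so that all higher derivatives vanish where the function is constant.\<close>

lemma derivative_tower_locally_constant:
  fixes U :: "nat \<Rightarrow> real \<Rightarrow> real"
  assumes U: "derivative_tower U" and S: "open S" and const: "\<And>t. t \<in> S \<Longrightarrow> U 0 t = c"
    and t: "t \<in> S"
  shows "U (Suc k) t = 0"
proof -
  have step: "U (Suc k) t = 0" if "\<And>t. t \<in> S \<Longrightarrow> U k t = d" "t \<in> S" for k d t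
  proof (rule DERIV_unique)
    show "(U k has_real_derivative U (Suc k) t) (at t)"
      using U by (simp add: derivative_tower_real_iff)
    show "(U k has_real_derivative 0) (at t)"
      by (rule has_field_derivative_transform_within_open[OF DERIV_const[of d] S that(2)])
        (simp add: that(1))
  qed
  have "\<forall>t\<in>S. U (Suc k) t = 0"
  proof (induction k)
    case 0 then show ?case using step[of 0 c] const by blast
  next
    case (Suc k) then show ?case using step[of "Suc k" 0] by blast
  qed
  then show ?thesis using t by blast
qed

lemma taylor_polynomial_tower:
  fixes a :: "nat \<Rightarrow> real"
  shows "derivative_tower (\<lambda>i t. \<Sum>p<Suc j - i. a (i + p) * t ^ p / fact p)"
  unfolding derivative_tower_real_iff
proof (intro allI)
  fix i :: nat and t :: real
  show "((\<lambda>t. \<Sum>p<Suc j - i. a (i + p) * t ^ p / fact p) has_real_derivative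
          (\<Sum>p<Suc j - Suc i. a (Suc i + p) * t ^ p / fact p)) (at t)"
  proof (cases "i \<le> j")
    case True
    then have "Suc j - i = Suc (j - i)" by auto
    moreover have "((\<lambda>t. a i + (\<Sum>p<j - i. a (Suc (i + p)) * t ^ Suc p / fact (Suc p))) 
        has_real_derivative (\<Sum>p<j - i. a (Suc (i + p)) * t ^ p / fact p)) (at t)"
    proof -
      have "((\<lambda>t. a (Suc (i + p)) * t ^ Suc p / fact (Suc p)) has_real_derivative
              a (Suc (i + p)) * t ^ p / fact p) (at t)" for p
      proof -
        have "((\<lambda>t. a (Suc (i + p)) / fact (Suc p) * t ^ Suc p) has_real_derivative
            a (Suc (i + p)) / fact (Suc p) * (real (Suc p) * t ^ p)) (at t)"
          by (intro DERIV_cmult) (use DERIV_pow[of "Suc p" t UNIV] in simp)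
        moreover have "a (Suc (i + p)) / fact (Suc p) * (real (Suc p) * t ^ p) = a (Suc (i + p)) * t ^ p / fact p"
        proof -
          have "fact (Suc p) = real (Suc p) * fact p" by (rule fact_Suc)
          then show ?thesis by (simp add: field_simps del: fact_Suc of_nat_Suc)
        qed
        ultimately show ?thesis by (simp only: times_divide_eq_left)
      qed
      then have "((\<lambda>t. \<Sum>p<j - i. a (Suc (i + p)) * t ^ Suc p / fact (Suc p)) 
        has_real_derivative (\<Sum>p<j - i. a (Suc (i + p)) * t ^ p / fact p)) (at t)" 
        by (rule DERIV_sum)
      from DERIV_add[OF DERIV_const[of "a i"] this] show ?thesis by (simp only: add_0)
    qed
    ultimately show ?thesis
      by (simp add: sum.lessThan_Suc_shift del: sum.lessThan_Suc power_Suc fact_Suc)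
  qed simp
qed

text \<open>The derivatives of \<open>t\<^sup>j / j!\<close>.\<close>

definition monomial_tower :: "nat \<Rightarrow> nat \<Rightarrow> real \<Rightarrow> real" where
  "monomial_tower j m t = (if m \<le> j then t ^ (j - m) / fact (j - m) else 0)"

lemma derivative_tower_monomial: "derivative_tower (monomial_tower j)"
proof -
  have "monomial_tower j = (\<lambda>i t. \<Sum>p<Suc j - i. (if i + p = j then 1 else 0) * t ^ p / fact p)"
  proof (intro ext)
    fix i and t :: real
    have "(\<Sum>p<Suc j - i. (if i + p = j then 1 else 0) * t ^ p / fact p)
        = (\<Sum>p<Suc j - i. if p = j - i then t ^ p / fact p else 0)"
      by (intro sum.cong) auto
    also have "\<dots> = monomial_tower j i t" by (auto simp: monomial_tower_def)
    finally show "monomial_tower j i t = (\<Sum>p<Suc j - i. (if i + p = j then 1 else 0) * t ^ p / fact p)" by simp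
  qed
  then show ?thesis using taylor_polynomial_tower[of "\<lambda>k. if k = j then 1 else 0" j] by simp
qed

text \<open>The Leibniz rule; the step from \<open>k\<close> to \<open>k + 1\<close> is Pascal's identity.\<close>

lemma leibniz_tower:
  fixes U P :: "nat \<Rightarrow> real \<Rightarrow> real"
  assumes U: "derivative_tower U" and P: "derivative_tower P"
  shows "derivative_tower (\<lambda>k t. \<Sum>i\<le>k. real (k choose i) * (U i t * P (k - i) t))"
  unfolding derivative_tower_real_iff
proof (intro allI)
  fix k t
  have "((\<lambda>t. \<Sum>i\<le>k. real (k choose i) * (U i t * P (k - i) t)) has_real_derivative
      (\<Sum>i\<le>k. real (k choose i) * (U (Suc i) t * P (k - i) t + P (Suc (k - i)) t * U i t))) (at t)"
    using U P unfolding derivative_tower_real_iff by (intro DERIV_sum DERIV_cmult DERIV_mult) auto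
  also have "(\<Sum>i\<le>k. real (k choose i) * (U (Suc i) t * P (k - i) t + P (Suc (k - i)) t * U i t))
      = (\<Sum>i\<le>k. real (k choose i) * (U (Suc i) t * P (k - i) t))
        + (\<Sum>i\<le>k. real (k choose i) * (U i t * P (Suc k - i) t))"
    unfolding sum.distrib[symmetric] by (intro sum.cong) (auto simp: algebra_simps Suc_diff_le)
  also have "(\<Sum>i\<le>k. real (k choose i) * (U i t * P (Suc k - i) t))
      = (\<Sum>i\<le>Suc k. real (k choose i) * (U i t * P (Suc k - i) t))" by simp
  also have "\<dots> = U 0 t * P (Suc k) t + (\<Sum>i\<le>k. real (k choose Suc i) * (U (Suc i) t * P (k - i) t))"
    by (subst sum.atMost_Suc_shift) simp
  also have "(\<Sum>i\<le>k. real (k choose i) * (U (Suc i) t * P (k - i) t)) + \<dots>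
      = U 0 t * P (Suc k) t + (\<Sum>i\<le>k. real (Suc k choose Suc i) * (U (Suc i) t * P (k - i) t))"
    by (simp add: algebra_simps sum.distrib)
  also have "\<dots> = (\<Sum>i\<le>Suc k. real (Suc k choose i) * (U i t * P (Suc k - i) t))"
    by (subst sum.atMost_Suc_shift) simp
  finally show "((\<lambda>t. \<Sum>i\<le>k. real (k choose i) * (U i t * P (k - i) t)) has_real_derivative
      (\<Sum>i\<le>Suc k. real (Suc k choose i) * (U i t * P (Suc k - i) t))) (at t)" .
qed

section \<open>Partial products, tails and weight sequences\<close>

definition partial_prod :: "(nat \<Rightarrow> real) \<Rightarrow> nat \<Rightarrow> real" where
  "partial_prod \<nu> k = (\<Prod>i=1..k. \<nu> i)"

lemma partial_prod_0 [simp]: "partial_prod \<nu> 0 = 1"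
  by (simp add: partial_prod_def)

lemma partial_prod_Suc [simp]: "partial_prod \<nu> (Suc k) = partial_prod \<nu> k * \<nu> (Suc k)"
  by (simp add: partial_prod_def)

lemma partial_prod_pos: "(\<And>l. 0 < \<nu> l) \<Longrightarrow> 0 < partial_prod \<nu> k"
  by (simp add: partial_prod_def prod_pos)

lemma partial_prod_add_le:
  assumes "mono \<nu>" "\<And>l. 0 < \<nu> l" "k + i \<le> n"
  shows "partial_prod \<nu> (k + i) \<le> partial_prod \<nu> k * \<nu> n ^ i"
  using assms(3)
proof (induction i)
  case (Suc i)
  have "partial_prod \<nu> (k + Suc i) = partial_prod \<nu> (k + i) * \<nu> (Suc (k + i))" by simp
  also have "\<dots> \<le> (partial_prod \<nu> k * \<nu> n ^ i) * \<nu> n"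
    using Suc assms(1,2) by (intro mult_mono) 
     (auto simp: monoD less_imp_le partial_prod_pos intro!: mult_nonneg_nonneg zero_le_power)
  finally show ?case by (simp add: mult_ac)
qed simp

lemma partial_prod_add:
  "partial_prod \<nu> (j + q) = partial_prod \<nu> j * (\<Prod>l<q. \<nu> (j + Suc l))"
  by (induction q) (auto simp: mult_ac)

lemma partial_prod_mono:
  assumes "\<And>l. 1 \<le> l \<Longrightarrow> l \<le> i \<Longrightarrow> \<nu> l \<le> \<sigma> l" "\<And>l. 0 < \<nu> l"
  shows "partial_prod \<nu> i \<le> partial_prod \<sigma> i"
  unfolding partial_prod_def using assms by (intro prod_mono) (auto simp: less_imp_le)

text \<open>The quotient of the two partial products is nonincreasing from the index \<open>L\<close> on.\<close>

lemma partial_prod_eventually_le: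
  assumes pos: "\<And>l. 0 < \<sigma> l" "\<And>l. 0 < \<kappa> l" and le: "\<And>l. l \<ge> L \<Longrightarrow> \<sigma> l \<le> \<kappa> l"
  shows "\<exists>D\<ge>0. \<forall>k. partial_prod \<sigma> k \<le> D * partial_prod \<kappa> k"
proof -
  define \<rho> where "\<rho> k = partial_prod \<sigma> k / partial_prod \<kappa> k" for k
  have P: "0 < partial_prod \<sigma> k" "0 < partial_prod \<kappa> k" for k using pos by (simp_all add: partial_prod_pos)
  have \<rho>_pos: "0 < \<rho> k" for k using P by (simp add: \<rho>_def)
  define D where "D = (\<Sum>k\<le>L. \<rho> k)"
  have "\<rho> k \<le> D" if "k \<le> L" for k
    unfolding D_def using that \<rho>_pos by (intro member_le_sum) (auto simp: less_imp_le)
  moreover have "\<rho> k \<le> \<rho> L" if "L \<le> k" for k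
    using that
  proof (induction k rule: dec_induct)
    case (step k)
    have "\<rho> (Suc k) = \<rho> k * (\<sigma> (Suc k) / \<kappa> (Suc k))" by (simp add: \<rho>_def)
    also have "\<dots> \<le> \<rho> k * 1"
      using le[of "Suc k"] step pos(2)[of "Suc k"] \<rho>_pos[of k] by (intro mult_left_mono) auto
    finally show ?case using step by simp
  qed simp
  ultimately have "\<rho> k \<le> D" for k by (meson nat_le_linear order_refl order_trans)
  then have "partial_prod \<sigma> k \<le> D * partial_prod \<kappa> k" for k
    using P(2)[of k] by (simp add: \<rho>_def divide_le_eq)
  moreover have "0 \<le> D" unfolding D_def using \<rho>_pos by (intro sum_nonneg) (auto simp: less_imp_le)
  ultimately show ?thesis by blast
qed

lemma partial_prod_scaled: "partial_prod (\<lambda>l. \<nu> l / s) k = partial_prod \<nu> k / s ^ k"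
  by (simp add: partial_prod_def prod_dividef)

text \<open>The value at \<open>0\<close> repeats the one at \<open>1\<close>, which makes the sequence monotone on all of \<open>nat\<close>.\<close>

definition quotients :: "(nat \<Rightarrow> real) \<Rightarrow> nat \<Rightarrow> real" where
  "quotients M l = quotient_seq M (max 1 l)"

lemma quotients_Suc: "quotients M (Suc l) = M (Suc l) / M l"
  by (simp add: quotients_def quotient_seq_def)

lemma weight_sequence_quotients:
  assumes "weight_sequence M"
  shows "mono (quotients M)" "0 < quotients M l" "partial_prod (quotients M) = M" "0 < M k"
proof -
  from assms obtain \<mu> where M0: "M 0 = 1" and \<mu>: "0 < \<mu> 1" "\<And>k. k \<ge> 1 \<Longrightarrow> \<mu> k \<le> \<mu> (Suc k)" and M: "\<And>k. k \<ge> 1 \<Longrightarrow> M k = (\<Prod>i=1..k. \<mu> i)"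
    unfolding weight_sequence_def by blast
  have M': "M k = partial_prod \<mu> k" for k
    using M0 M[of k] by (cases k) (auto simp: partial_prod_def)
  have \<mu>_pos: "0 < \<mu> (Suc k)" for k
  proof (induction k)
    case (Suc k)
    then show ?case using \<mu>(2)[of "Suc k"] by simp
  qed (use \<mu>(1) in simp)
  have Mpos: "0 < M k" for k unfolding M' partial_prod_def 
    by (intro prod_pos) (metis Suc_le_D \<mu>_pos atLeastAtMost_iff One_nat_def)
  then show "0 < M k" .
  have q: "quotients M (Suc l) = \<mu> (Suc l)" for l
    using Mpos[of l] by (simp add: quotients_Suc M')
  have q0: "quotients M 0 = quotients M (Suc 0)" by (simp add: quotients_def)
  show mono: "mono (quotients M)"
  proof (rule incseq_SucI)
    fix l show "quotients M l \<le> quotients M (Suc l)"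
      using q0 q \<mu>(2)[of l] by (cases l) auto
  qed
  show "0 < quotients M l" using q0 q \<mu>_pos by (cases l) auto
  show "partial_prod (quotients M) = M"
  proof
    fix k show "partial_prod (quotients M) k = M k" 
    proof (induction k)
      case (Suc k)
      then show ?case using Mpos[of k] by (simp add: quotients_Suc)
    qed (simp add: M0)
  qed
qed

definition tail_sum :: "(nat \<Rightarrow> real) \<Rightarrow> nat \<Rightarrow> real" where
  "tail_sum \<nu> j = (\<Sum>k. 1 / \<nu> (j + k))"

lemma summable_tail:
  "summable (\<lambda>l. 1 / \<nu> l) \<Longrightarrow> summable (\<lambda>k. 1 / (\<nu> (j + k) :: real))"
  using summable_iff_shift[of "\<lambda>l. 1 / \<nu> l" j] by (simp add: add.commute)

lemma tail_sum_pos: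
  assumes "summable (\<lambda>l. 1 / \<nu> l)" "\<And>l. 0 < \<nu> l"
  shows "0 < tail_sum \<nu> j"
  unfolding tail_sum_def using summable_tail[OF assms(1)] assms(2) by (intro suminf_pos) auto

lemma tail_sum_Suc:
  assumes "summable (\<lambda>l. 1 / \<nu> l)"
  shows "tail_sum \<nu> j = 1 / \<nu> j + tail_sum \<nu> (Suc j)"
  unfolding tail_sum_def using suminf_split_head[OF summable_tail[OF assms, of j]] by simp

lemma partial_tail_sum:
  "(\<Sum>l\<in>{j<..j + m}. f l) = (\<Sum>k<m. f (Suc j + k))" for f :: "nat \<Rightarrow> real"
  by (rule sum.reindex_bij_witness[of _ "\<lambda>k. Suc j + k" "\<lambda>l. l - Suc j"]) auto

lemma tail_sum_antimono:
  assumes "summable (\<lambda>l. 1 / \<nu> l)" "\<And>l. 0 < \<nu> l" "i \<le> j"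
  shows "tail_sum \<nu> j \<le> tail_sum \<nu> i"
  using assms(3)
proof (induction j rule: dec_induct)
  case (step n)
  then show ?case using tail_sum_Suc[OF assms(1), of n] assms(2)[of n] 
    by (smt (verit) zero_less_divide_1_iff)
qed simp

lemma tail_sum_scaled:
  assumes "summable (\<lambda>l. 1 / \<nu> l)"
  shows "tail_sum (\<lambda>l. \<nu> l / s) j = s * tail_sum \<nu> j"
  unfolding tail_sum_def using suminf_mult[OF summable_tail[OF assms, of j], of s] by simp

section \<open>Bang's estimate and Taylor coefficients\<close>

lemma sum_power_div_fact_le_exp:
  fixes x :: real assumes "0 \<le> x" shows "(\<Sum>i<n. x ^ i / fact i) \<le> exp x"
proof -
  have "(\<Sum>i<n. x ^ i / fact i) \<le> (\<Sum>i. x ^ i / fact i)"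
    using assms summable_exp[of x] by (intro sum_le_suminf) (auto simp: field_simps)
  then show ?thesis by (simp add: exp_def field_simps)
qed

text \<open>Bang's estimate for functions that are flat up to the order \<open>n\<close>. The bound at level \<open>m\<close> loses a
  factor \<open>e\<close> against the bound at level \<open>m + 1\<close>, and this loss takes at least the distance
  \<open>1 / (e \<nu>\<^sub>m\<^sub>+\<^sub>1)\<close>: on such a distance, Taylor's formula of order \<open>m + 1\<close> and the
  inequality \<open>N\<^sub>k\<^sub>+\<^sub>i \<le> N\<^sub>k \<nu>\<^bsup>i\<^esup>\<close>, with \<open>\<nu> = \<nu>\<^sub>m\<^sub>+\<^sub>1\<close>, reproduce an exponential series with
  argument at most \<open>1\<close>. Summing the distances downwards from \<open>n\<close> gives the range of \<open>t\<close>.\<close>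

lemma bang_estimate:
  fixes F :: "nat \<Rightarrow> real \<Rightarrow> real"
  assumes F: "derivative_tower F"
    and \<nu>: "mono \<nu>" "\<And>l. 0 < \<nu> l" and A: "0 \<le> A"
    and bound: "\<And>k t. 0 \<le> t \<Longrightarrow> t \<le> T \<Longrightarrow> \<bar>F k t\<bar> \<le> A * partial_prod \<nu> k"
    and flat: "\<And>k. k < n \<Longrightarrow> F k 0 = 0"
    and "m \<le> n" and t: "0 \<le> t" "t \<le> T" "t \<le> (\<Sum>l\<in>{m<..n}. 1 / \<nu> l) / exp 1"
  shows "\<bar>F k t\<bar> \<le> A * exp (real k - real m) * partial_prod \<nu> k"
  using \<open>m \<le> n\<close> t
proof (induction m arbitrary: t k rule: inc_induct)
  case base
  show ?case
  proof (cases "k < n")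
    case True
    then show ?thesis using flat base A \<nu>(2) partial_prod_pos[of \<nu> k] by simp
  next
    case False
    then have "1 \<le> exp (real k - real n)" by simp
    then have "A * partial_prod \<nu> k * 1 \<le> A * partial_prod \<nu> k * exp (real k - real n)"
      using A partial_prod_pos[of \<nu> k] \<nu>(2) by (intro mult_left_mono) (auto simp: less_imp_le)
    then show ?thesis using bound[of t k] base by (simp add: mult_ac)
  qed
next
  case (step m)
  let ?N = "partial_prod \<nu>" 
  let ?s = "(\<Sum>l\<in>{Suc m<..n}. 1 / \<nu> l) / exp 1"
  have Npos: "0 < ?N i" for i using \<nu>(2) by (rule partial_prod_pos)
  have s_nonneg: "0 \<le> ?s" using \<nu>(2) by (auto intro!: sum_nonneg divide_nonneg_pos simp: less_imp_le)
  have split: "{m<..n} = insert (Suc m) {Suc m<..n}" using step.hyps by auto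
  show ?case
  proof (cases "k \<le> m")
    case False
    then have "1 \<le> exp (real k - real m)" by simp
    then have "A * ?N k * 1 \<le> A * ?N k * exp (real k - real m)"
      using A Npos[of k] by (intro mult_left_mono) (auto simp: less_imp_le)
    then show ?thesis using bound[of t k] step.prems by (simp add: mult_ac)
  next
    case True
    show ?thesis
    proof (cases "t \<le> ?s")
      case True
      then have "\<bar>F k t\<bar> \<le> A * exp (real k - real (Suc m)) * ?N k"
        using step by auto
      also have "\<dots> \<le> A * exp (real k - real m) * ?N k"
        using A Npos[of k] by (intro mult_right_mono mult_left_mono) auto
      finally show ?thesis .
    next
      case False
      define \<tau> where "\<tau> = t - ?s"
      have \<tau>: "0 < \<tau>" "exp 1 * \<nu> (Suc m) * \<tau> \<le> 1"
      proof -
        show "0 < \<tau>" using False by (simp add: \<tau>_def)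
        have "\<tau> \<le> 1 / \<nu> (Suc m) / exp 1"
          using step.prems by (simp add: \<tau>_def split add_divide_distrib)
        then show "exp 1 * \<nu> (Suc m) * \<tau> \<le> 1" using \<nu>(2)[of "Suc m"] by (simp add: field_simps)
      qed
      define d where "d = Suc m - k"
      have d: "0 < d" "k + d = Suc m" using True by (auto simp: d_def)
      \<comment> \<open>The Taylor coefficients at \<open>?s\<close> have order at most \<open>m\<close> and are controlled by the induction
        hypothesis; the remainder has order \<open>m + 1\<close>, where the a priori bound has no exponential gain.\<close>
      have "\<exists>\<xi>>?s. \<xi> < t \<and> F k t = (\<Sum>i<d. F (k + i) ?s / fact i * (t - ?s) ^ i)
            + F (k + d) \<xi> / fact d * (t - ?s) ^ d"
        using F False d(1) unfolding derivative_tower_real_iff 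
        by (intro Taylor_up[of d "\<lambda>i. F (k + i)" _ ?s t ?s]) auto
      then obtain \<xi> where \<xi>: "?s < \<xi>" "\<xi> < t"
        and taylor: "F k t = (\<Sum>i<d. F (k + i) ?s / fact i * \<tau> ^ i) + F (k + d) \<xi> / fact d * \<tau> ^ d"
        unfolding \<tau>_def by blast
      have Nle: "?N (k + i) \<le> ?N k * \<nu> (Suc m) ^ i" if "i \<le> d" for i
        using that d by (intro partial_prod_add_le \<nu>) auto
      let ?B = "A * exp (real k - real (Suc m)) * ?N k"
      have term_le: "\<bar>y / fact i * \<tau> ^ i\<bar> \<le> ?B * ((exp 1 * \<nu> (Suc m) * \<tau>) ^ i / fact i)"
        if "\<bar>y\<bar> \<le> A * exp (real (k + i) - real (Suc m)) * ?N (k + i)" "i \<le> d" for y i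
      proof -
        have "\<bar>y\<bar> \<le> A * exp (real (k + i) - real (Suc m)) * (?N k * \<nu> (Suc m) ^ i)"
          using that(1) Nle[OF that(2)] A by (meson order_trans mult_left_mono exp_ge_zero mult_nonneg_nonneg)
        also have "exp (real (k + i) - real (Suc m)) = exp (real k - real (Suc m)) * exp 1 ^ i"
          by (simp add: exp_add[symmetric] exp_of_nat_mult[symmetric] algebra_simps)
        finally have "\<bar>y\<bar> * (\<tau> ^ i / fact i) \<le> 
           (A * (exp (real k - real (Suc m)) * exp 1 ^ i) * (?N k * \<nu> (Suc m) ^ i)) * (\<tau> ^ i / fact i)"
          using \<tau> by (intro mult_right_mono) auto
        then show ?thesis using \<tau>(1) by (simp add: abs_mult power_mult_distrib mult_ac)
      qed
      have "\<bar>F k t\<bar> \<le> (\<Sum>i<d. \<bar>F (k + i) ?s / fact i * \<tau> ^ i\<bar>) + \<bar>F (k + d) \<xi> / fact d * \<tau> ^ d\<bar>"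
        unfolding taylor by (rule order_trans[OF abs_triangle_ineq add_right_mono[OF sum_abs]])
      also have "\<dots> \<le> (\<Sum>i<d. ?B * ((exp 1 * \<nu> (Suc m) * \<tau>) ^ i / fact i))
          + ?B * ((exp 1 * \<nu> (Suc m) * \<tau>) ^ d / fact d)"
      proof (intro add_mono sum_mono term_le)
        fix i assume "i \<in> {..<d}"
        then show "i \<le> d" by simp
        show "\<bar>F (k + i) ?s\<bar> \<le> A * exp (real (k + i) - real (Suc m)) * ?N (k + i)"
          using step.prems False s_nonneg by (intro step.IH) auto
      next
        show "\<bar>F (k + d) \<xi>\<bar> \<le> A * exp (real (k + d) - real (Suc m)) * ?N (k + d)"
          using bound[of \<xi> "k + d"] \<xi> s_nonneg step.prems unfolding d(2) by simp
      qed simp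
      also have "\<dots> = ?B * (\<Sum>i<Suc d. (exp 1 * \<nu> (Suc m) * \<tau>) ^ i / fact i)"
        by (simp add: sum_distrib_left algebra_simps)
      also have "\<dots> \<le> ?B * exp 1"
      proof (rule mult_left_mono)
        show "(\<Sum>i<Suc d. (exp 1 * \<nu> (Suc m) * \<tau>) ^ i / fact i) \<le> exp 1"
          by (rule order_trans[OF sum_power_div_fact_le_exp]) (use \<tau> \<nu>(2)[of "Suc m"] in auto)
        show "0 \<le> ?B" using A Npos[of k] by simp
      qed
      also have "\<dots> = A * (exp (real k - real (Suc m)) * exp 1) * ?N k" by (simp add: mult_ac)
      also have "exp (real k - real (Suc m)) * exp 1 = exp (real k - real m)"
        by (simp add: exp_add[symmetric])
      finally show ?thesis .
    qed
  qed
qed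

text \<open>Let \<open>P\<close> be the Taylor polynomial of degree \<open>j\<close> at \<open>0\<close>. As long as the derivatives of \<open>P\<close> are
  bounded by \<open>4 C N\<^sub>i\<close>, those of \<open>F - P\<close> are bounded by \<open>5 C N\<^sub>i\<close>, and this difference is flat up
  to the order \<open>n\<close>. Bang's estimate then gains a factor \<open>e\<^sup>i\<^sup>-\<^sup>j\<close> and shows that the derivatives
  of \<open>P\<close> of order \<open>i < j\<close> are in fact strictly below \<open>4 C N\<^sub>i\<close>; the one of order \<open>j\<close> is constant and
  at most \<open>C N\<^sub>j\<close>. As they start below this threshold at \<open>0\<close>, they can
  never reach it. Nonnegativity of the jet makes \<open>P\<close> and its derivatives monotone and lets a
  single term of \<open>P\<close> be estimated by \<open>P\<close>.\<close>

lemma taylor_coefficient_bound: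
  fixes F :: "nat \<Rightarrow> real \<Rightarrow> real"
  assumes F: "derivative_tower F"
    and \<nu>: "mono \<nu>" "\<And>l. 0 < \<nu> l" and C: "0 < C"
    and bound: "\<And>k t. 0 \<le> t \<Longrightarrow> t \<le> h \<Longrightarrow> \<bar>F k t\<bar> \<le> C * partial_prod \<nu> k"
    and nonneg: "\<And>k. k \<le> j \<Longrightarrow> 0 \<le> F k 0"
    and gap: "\<And>k. j < k \<Longrightarrow> k < n \<Longrightarrow> F k 0 = 0"
    and "j \<le> n" "0 \<le> h" "h \<le> (\<Sum>l\<in>{j<..n}. 1 / \<nu> l) / exp 1" "i \<le> j"
  shows "F j 0 * h ^ (j - i) / fact (j - i) \<le> 4 * C * partial_prod \<nu> i"
proof -
  let ?N = "partial_prod \<nu>"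
  define P where "P = (\<lambda>i t. \<Sum>p<Suc j - i. F (i + p) 0 * t ^ p / fact p)"
  have Npos: "0 < ?N i" for i using \<nu>(2) by (rule partial_prod_pos)
  have P_tower: "derivative_tower P" unfolding P_def by (rule taylor_polynomial_tower[of "\<lambda>k. F k 0"])
  have P_mono: "P i s \<le> P i t" if "0 \<le> s" "s \<le> t" for i s t
    unfolding P_def using that nonneg
    by (intro sum_mono divide_right_mono mult_left_mono power_mono) auto
  have P_zero: "P i 0 = F i 0" if "i \<le> j" for i
  proof -
    have "Suc j - i = Suc (j - i)" using that by auto
    then show ?thesis
      unfolding P_def by (simp add: sum.lessThan_Suc_shift del: sum.lessThan_Suc)
  qed
  have P_nonneg: "0 \<le> P i t" if "0 \<le> t" for i t
    unfolding P_def using that nonneg by (intro sum_nonneg) auto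
  have improve: "P i t < 4 * C * ?N i"
    if t: "0 \<le> t" "t \<le> h" and le: "\<And>i. i \<le> j \<Longrightarrow> P i t \<le> 4 * C * ?N i" and "i \<le> j" for t i
  proof (cases "i = j")
    case True
    have "P j t = F j 0" by (simp add: P_def)
    also have "\<dots> \<le> C * ?N j" using bound[of 0 j] \<open>0 \<le> h\<close> by simp
    also have "\<dots> < 4 * C * ?N j" using C Npos[of j] by simp
    finally show ?thesis using True by simp
  next
    case False
    with \<open>i \<le> j\<close> have "i < j" by simp
    have "\<bar>F i t - P i t\<bar> \<le> 5 * C * exp (real i - real j) * ?N i"
    proof (rule bang_estimate[where F = "\<lambda>k t. F k t - P k t" and T = t and n = n])
      show "derivative_tower (\<lambda>k t. F k t - P k t)" by (rule derivative_tower_diff[OF F P_tower])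
      show "\<bar>F k s - P k s\<bar> \<le> 5 * C * ?N k" if "0 \<le> s" "s \<le> t" for k s
      proof -
        have "P k s \<le> 4 * C * ?N k"
        proof (cases "k \<le> j")
          case True then show ?thesis using le[OF True] P_mono[OF that, of k] by linarith
        next
          case False then show ?thesis using C Npos[of k] by (simp add: P_def)
        qed
        then show ?thesis using bound[of s k] P_nonneg[of s k] that t by linarith
      qed
      show "F k 0 - P k 0 = 0" if "k < n" for k
        using P_zero[of k] gap[of k] that by (cases "k \<le> j") (auto simp: P_def)
    qed (use t C \<nu> assms in auto)
    also have "\<dots> \<le> 5 * C * exp (-1) * ?N i"
      using C Npos[of i] \<open>i < j\<close> by (intro mult_right_mono mult_left_mono) auto
    also have "\<dots> \<le> 5 * C * (1 / 2) * ?N i"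
    proof (intro mult_right_mono mult_left_mono)
      have "exp (1 :: real) \<ge> 2" using exp_ge_add_one_self[of 1] by simp
      then show "exp (-1) \<le> (1 / 2 :: real)" by (simp add: exp_minus field_simps)
    qed (use C Npos[of i] in auto)
    finally have "P i t \<le> C * ?N i + 5 * C * (1 / 2) * ?N i" using bound[OF t, of i] by linarith
    also have "\<dots> < 4 * C * ?N i" using C Npos[of i] by simp
    finally show ?thesis .
  qed
  have main: "P i h \<le> 4 * C * ?N i" if "i \<le> j" for i
  proof (rule ccontr)
    assume "\<not> P i h \<le> 4 * C * ?N i"
    \<comment> \<open>\<open>V\<close> collects the orders that exceed the threshold at \<open>h\<close>; the contradiction arises at
      the first point \<open>t\<close> where one of them attains the threshold.\<close>
    define V where "V = {i. i \<le> j \<and> 4 * C * ?N i < P i h}"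
    have V: "finite V" "V \<noteq> {}"
    proof -
      show "finite V" by (rule finite_subset[of _ "{..j}"]) (auto simp: V_def)
      have "i \<in> V" using that \<open>\<not> P i h \<le> 4 * C * ?N i\<close> by (simp add: V_def)
      then show "V \<noteq> {}" by auto
    qed
    have "\<exists>t. 0 \<le> t \<and> t \<le> h \<and> P i t = 4 * C * ?N i" if "i \<in> V" for i
    proof (rule IVT')
      show "P i 0 \<le> 4 * C * ?N i"
        using that P_zero[of i] bound[of 0 i] \<open>0 \<le> h\<close> C Npos[of i] by (auto simp: V_def)
      show "continuous_on {0..h} (P i)"
        unfolding P_def by (intro continuous_intros) auto
    qed (use that \<open>0 \<le> h\<close> in \<open>auto simp: V_def\<close>)
    then obtain \<tau> where \<tau>: "\<And>i. i \<in> V \<Longrightarrow> 0 \<le> \<tau> i \<and> \<tau> i \<le> h \<and> P i (\<tau> i) = 4 * C * ?N i" by metis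
    define t where "t = Min (\<tau> ` V)"
    have "t \<in> \<tau> ` V" unfolding t_def using V by (intro Min_in) auto
    then obtain i0 where i0: "i0 \<in> V" "t = \<tau> i0" by auto
    have t: "0 \<le> t" "t \<le> h" using \<tau>[OF i0(1)] i0(2) by auto
    have "P i t \<le> 4 * C * ?N i" if "i \<le> j" for i
    proof (cases "i \<in> V")
      case True
      then have "t \<le> \<tau> i" unfolding t_def using V by (intro Min_le) auto
      then show ?thesis using P_mono[OF t(1), of "\<tau> i" i] \<tau>[OF True] by simp
    next
      case False
      then show ?thesis using P_mono[OF t, of i] that by (simp add: V_def)
    qed
    then have "P i0 t < 4 * C * ?N i0" using t i0 by (intro improve) (auto simp: V_def)
    then show False using \<tau>[OF i0(1)] i0(2) by simp
  qed
  have "F (i + (j - i)) 0 * h ^ (j - i) / fact (j - i) \<le> P i h"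
    unfolding P_def using nonneg \<open>0 \<le> h\<close> \<open>i \<le> j\<close>
    by (intro member_le_sum[where f = "\<lambda>p. F (i + p) 0 * h ^ p / fact p"]) auto
  with main[OF \<open>i \<le> j\<close>] \<open>i \<le> j\<close> show ?thesis by simp
qed

section \<open>The mixed condition without roots\<close>

lemma powr_inverse_mult_le_iff:
  fixes x y C :: real
  assumes "0 < x" "0 \<le> y" "0 \<le> C" "0 < d"
  shows "x powr (1 / real d) * y \<le> C \<longleftrightarrow> x * y ^ d \<le> C ^ d"
proof -
  have "(x powr (1 / real d)) ^ d = x"
    using assms by (simp add: powr_powr flip: powr_realpow)
  then have "(x powr (1 / real d) * y) ^ d = x * y ^ d" by (simp add: power_mult_distrib)
  then show ?thesis
    using power_mono_iff[of "x powr (1 / real d) * y" C d] assms by simp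
qed

text \<open>The instance \<open>j = 1\<close>, \<open>i = 0\<close> of the condition bounds the whole series.\<close>

lemma prec_SV_imp_summable:
  assumes "weight_sequence M" "weight_sequence N" "M \<prec>\<^sub>S\<^sub>V N"
  shows "summable (\<lambda>l. 1 / quotients N l)"
proof -
  from assms(3) obtain C s :: nat where Cs: "C \<ge> 1" "s \<ge> 1" and
   "(SUP j\<in>{1..}. SUP i\<in>{0..<j}.
        ennreal ((M j / (real s ^ j * N i)) powr (1 / real (j - i))) * ennreal (1 / real j) *
        (\<Sum>k. ennreal (N (j + k - 1) / N (j + k)))) \<le> ennreal (real C)"
    unfolding prec_SV_def by blast
  then have "ennreal ((M 1 / (real s ^ 1 * N 0)) powr (1 / real (1 - 0))) * ennreal (1 / real 1) *
        (\<Sum>k. ennreal (N (1 + k - 1) / N (1 + k))) \<le> ennreal (real C)"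
    unfolding SUP_le_iff by (meson atLeast_iff atLeastLessThan_iff le0 le_refl less_one)
  moreover have "0 < M (Suc 0)" "0 < s" "0 < N 0"
    using Cs(2) weight_sequence_quotients(4)[OF assms(1)] weight_sequence_quotients(4)[OF assms(2)] by auto
  ultimately have fin: "(\<Sum>k. ennreal (N k / N (Suc k))) \<noteq> top"
    by (auto simp: ennreal_mult_top top_unique)
  have "summable (\<lambda>k. N k / N (Suc k))"
  proof (rule summable_suminf_not_top[OF _ fin])
    show "0 \<le> N k / N (Suc k)" for k using weight_sequence_quotients(4)[OF assms(2)] by (simp add: less_imp_le)
  qed
  then show ?thesis
    by (subst summable_Suc_iff[symmetric]) (simp add: quotients_Suc)
qed

text \<open>Taking \<open>(j - i)\<close>-th powers removes the roots, and summability removes the extended reals.\<close>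

lemma prec_SV_iff:
  assumes M: "weight_sequence M" and N: "weight_sequence N"
    and summable: "summable (\<lambda>l. 1 / quotients N l)"
  shows "M \<prec>\<^sub>S\<^sub>V N \<longleftrightarrow> (\<exists>C s :: nat. C \<ge> 1 \<and> s \<ge> 1 \<and> (\<forall>j\<ge>1. \<forall>i<j.
     M j * (tail_sum (quotients N) j / real j) ^ (j - i) \<le> real C ^ (j - i) * real s ^ j * N i))"
proof -
  note Mpos = weight_sequence_quotients(4)[OF M] and Npos = weight_sequence_quotients(4)[OF N]
  note qpos = weight_sequence_quotients(2)[OF N]
  have series: "(\<Sum>k. ennreal (N (j + k - 1) / N (j + k))) = ennreal (tail_sum (quotients N) j)"
    if "j \<ge> 1" for j
  proof -
    have "N (j + k - 1) / N (j + k) = 1 / quotients N (j + k)" for k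
      using that by (simp add: quotients_def quotient_seq_def)
    then show ?thesis
      unfolding tail_sum_def using summable_tail[OF summable, of j] qpos
      by (simp add: suminf_ennreal2 less_imp_le)
  qed
  have "ennreal ((M j / (real s ^ j * N i)) powr (1 / real (j - i))) * ennreal (1 / real j) *
        (\<Sum>k. ennreal (N (j + k - 1) / N (j + k))) \<le> ennreal (real C) \<longleftrightarrow>
     M j * (tail_sum (quotients N) j / real j) ^ (j - i) \<le> real C ^ (j - i) * real s ^ j * N i"
    if "j \<ge> 1" "i < j" "s \<ge> 1" for j i s C :: nat
  proof -
    let ?x = "M j / (real s ^ j * N i)" and ?S = "tail_sum (quotients N) j"
    have x: "0 < ?x" using Mpos Npos that by simp
    have S: "0 \<le> ?S" using tail_sum_pos[OF summable qpos] by (simp add: less_imp_le)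
    have "ennreal (?x powr (1 / real (j - i))) * ennreal (1 / real j) *
        (\<Sum>k. ennreal (N (j + k - 1) / N (j + k))) = ennreal (?x powr (1 / real (j - i)) * (?S / real j))"
      using S unfolding series[OF that(1)] by (simp add: ennreal_mult[symmetric])
    also have "\<dots> \<le> ennreal (real C) \<longleftrightarrow> ?x powr (1 / real (j - i)) * (?S / real j) \<le> real C"
      by (rule ennreal_le_iff) simp
    also have "\<dots> \<longleftrightarrow> ?x * (?S / real j) ^ (j - i) \<le> real C ^ (j - i)"
      using x S that by (intro powr_inverse_mult_le_iff) auto
    also have "\<dots> \<longleftrightarrow> M j * (?S / real j) ^ (j - i) \<le> real C ^ (j - i) * real s ^ j * N i"
    proof -
      have "0 < real s ^ j * N i" using that Npos by simp
      then show ?thesis by (simp add: pos_divide_le_eq mult_ac)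
    qed
    finally show ?thesis .
  qed
  then show ?thesis
    unfolding prec_SV_def SUP_le_iff by (intro ex_cong1) auto
qed

section \<open>Necessity by lacunary jets\<close>

text \<open>This is the failure of \<open>M \<prec>\<^sub>S\<^sub>V N\<close> in the form that contradicts \<open>taylor_coefficient_bound\<close>.
  A pair \<open>(j, i)\<close> that violates the condition with a huge constant \<open>C\<close> yields a large
  coefficient in one of two ways. If the first term \<open>1 / \<nu>\<^sub>j\<close> makes up at least half of the tail
  \<open>S\<^sub>j\<close>, then already \<open>M\<^sub>j / s\<^sup>j\<close> is much larger than \<open>N\<^sub>j\<close>, and one takes order \<open>j\<close> and \<open>h = 0\<close>.
  Otherwise a finite part of the tail after \<open>j\<close> is comparable to \<open>S\<^sub>j\<close>, and one takes
  order \<open>i\<close> and \<open>h\<close> a small multiple of \<open>S\<^sub>j\<close>.\<close>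

lemma not_prec_SV_large_coefficient:
  assumes M: "weight_sequence M" and N: "weight_sequence N"
    and not_prec: "\<not> M \<prec>\<^sub>S\<^sub>V N" and "s \<ge> 1"
    and summable: "summable (\<lambda>l. 1 / quotients N l)"
  shows "\<exists>j\<ge>J. \<exists>n\<ge>j. \<exists>i\<le>j. \<exists>h. 0 \<le> h \<and> h \<le> 1 \<and>
     h \<le> (\<Sum>l\<in>{j<..n}. 1 / quotients N l) / exp 1 \<and>
     K * N i < M j / real s ^ j * h ^ (j - i) / fact (j - i)"
proof -
  note Mpos = weight_sequence_quotients(4)[OF M] and Npos = weight_sequence_quotients(4)[OF N]
  note \<nu>_mono = weight_sequence_quotients(1)[OF N] and \<nu>_pos = weight_sequence_quotients(2)[OF N]
  let ?\<nu> = "quotients N"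
  let ?S = "tail_sum ?\<nu>"
  have S_pos: "0 < ?S j" for j by (rule tail_sum_pos[OF summable \<nu>_pos])
  \<comment> \<open>The normalization that puts \<open>h = S\<^sub>j / D\<close> into \<open>[0, 1]\<close> and below \<open>S\<^sub>j / (4 e)\<close>.\<close>
  define D where "D = 4 * exp 1 * (1 + ?S 0)"
  have "0 < D" using S_pos[of 0] by (simp add: D_def)
  define E where "E j i = M j * (?S j / real j) ^ (j - i) / (real s ^ j * N i)" for j i
  have E_nonneg: "0 \<le> E j i" for j i using Mpos[of j] Npos[of i] S_pos[of j] by (simp add: E_def)
  \<comment> \<open>The sum excludes the finitely many pairs with \<open>j < J\<close>; the other terms serve the two cases.\<close>
  obtain C :: nat where C: "real C \<ge> 2 + 2 * \<bar>K\<bar> + D * (1 + \<bar>K\<bar>) + (\<Sum>j<J. \<Sum>i<j. E j i)"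
    using real_arch_simple by blast
  have C_ge: "real C \<ge> 2 + 2 * \<bar>K\<bar>" "real C \<ge> D * (1 + \<bar>K\<bar>)" "real C \<ge> 1"
  proof -
    have "0 \<le> D * (1 + \<bar>K\<bar>)" "0 \<le> (\<Sum>j<J. \<Sum>i<j. E j i)" using \<open>0 < D\<close> E_nonneg by (auto intro!: sum_nonneg)
    then show "real C \<ge> 2 + 2 * \<bar>K\<bar>" "real C \<ge> D * (1 + \<bar>K\<bar>)" "real C \<ge> 1" using C by linarith+
  qed
  obtain j i where j: "j \<ge> 1" "i < j"
    and viol: "real C ^ (j - i) * real s ^ j * N i < M j * (?S j / real j) ^ (j - i)"
    using not_prec C_ge(3) \<open>s \<ge> 1\<close> unfolding prec_SV_iff[OF M N summable] 
    by (metis (no_types, lifting) not_le of_nat_1 of_nat_le_iff)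
  define d where "d = j - i"
  have d: "d \<ge> 1" "i + d = j" using j by (auto simp: d_def)
  have power_ge: "x \<le> x ^ d" if "1 \<le> x" for x :: real
    using power_increasing[OF d(1) that] by simp
  have s_pos: "0 < real s ^ j" using \<open>s \<ge> 1\<close> by simp
  define b where "b = M j / real s ^ j"
  have "0 < b" using Mpos s_pos by (simp add: b_def)
  have viol': "real C ^ d * N i < b * (?S j / real j) ^ d"
  proof -
    have "real C ^ d * N i * real s ^ j < M j * (?S j / real j) ^ d"
      using viol by (simp add: d_def mult_ac)
    then show ?thesis using s_pos unfolding b_def by (simp add: pos_less_divide_eq)
  qed
  have "J \<le> j"
  proof (rule ccontr)
    assume "\<not> J \<le> j"
    then have "E j i \<le> (\<Sum>i<j. E j i)" "(\<Sum>i<j. E j i) \<le> (\<Sum>j<J. \<Sum>i<j. E j i)"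
      using j E_nonneg 
      by (auto intro!: member_le_sum member_le_sum[of j "{..<J}" "\<lambda>j. \<Sum>i<j. E j i"] sum_nonneg)
    moreover have "0 \<le> D * (1 + \<bar>K\<bar>)" using \<open>0 < D\<close> by simp
    ultimately have "E j i \<le> real C" using C by linarith
    also have "\<dots> \<le> real C ^ d" by (rule power_ge[OF C_ge(3)])
    finally show False using viol s_pos Npos[of i] by (simp add: E_def d_def divide_le_eq mult_ac not_le)
  qed
  show ?thesis
  proof (cases "?S j / 2 \<le> 1 / ?\<nu> j")
    case True
    have "?S j / real j \<le> 2 / ?\<nu> j"
    proof -
      have "?S j / real j \<le> ?S j / 1" using j S_pos[of j] by (intro divide_left_mono) auto
      then show ?thesis using True by simp
    qed
    then have "b * (?S j / real j) ^ d \<le> b * (2 / ?\<nu> j) ^ d"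
      using \<open>0 < b\<close> S_pos[of j] by (intro mult_left_mono power_mono) auto
    with viol' have "real C ^ d * N i < b * (2 / ?\<nu> j) ^ d" by linarith
    then have "(real C / 2) ^ d * (N i * ?\<nu> j ^ d) < b"
      using \<nu>_pos[of j] by (simp add: power_divide field_simps)
    moreover have "N j \<le> N i * ?\<nu> j ^ d"
      using partial_prod_add_le[OF \<nu>_mono \<nu>_pos, of i d j] d(2) weight_sequence_quotients(3)[OF N] by simp
    moreover have "K * N j \<le> (real C / 2) ^ d * N j"
    proof (rule mult_right_mono)
      have "K \<le> real C / 2" "1 \<le> real C / 2" using C_ge by linarith+
      then show "K \<le> (real C / 2) ^ d" using power_ge[of "real C / 2"] by linarith
    qed (use Npos[of j] in simp)
    moreover have "(real C / 2) ^ d * N j \<le> (real C / 2) ^ d * (N i * ?\<nu> j ^ d)"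
      using calculation(2) by (intro mult_left_mono) auto
    ultimately have "K * N j < b" by linarith
    then show ?thesis
      using \<open>J \<le> j\<close> by (intro exI[of _ j] exI[of _ "0::real"] conjI) (auto simp: b_def)
  next
    case False
    then have "?S j / 2 < ?S (Suc j)" using tail_sum_Suc[OF summable, of j] by (simp add: field_simps)
    then have "eventually (\<lambda>m. ?S j / 4 < (\<Sum>k<m. 1 / ?\<nu> (Suc j + k))) sequentially"
      using summable_LIMSEQ[OF summable_tail[OF summable, of "Suc j"]] S_pos[of j]
      unfolding tail_sum_def[symmetric] by (intro order_tendstoD(1)) auto
    then obtain m where m: "?S j / 4 < (\<Sum>k<m. 1 / ?\<nu> (Suc j + k))"
      by (meson eventually_happens trivial_limit_sequentially)
    define h where "h = ?S j / D"
    have h: "0 \<le> h" "h \<le> 1" "h \<le> ?S j / 4 / exp 1"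
    proof -
      have exp1: "exp (1 :: real) \<ge> 1" by simp
      have Sj: "?S j \<le> ?S 0" by (rule tail_sum_antimono[OF summable \<nu>_pos]) simp
      have D': "D \<ge> 4 * exp 1" using S_pos[of 0] by (simp add: D_def algebra_simps)
      have "D \<ge> ?S 0" 
      proof -
        have "1 * (1 + ?S 0) \<le> 4 * exp 1 * (1 + ?S 0)" 
          using exp1 S_pos[of 0] by (intro mult_right_mono) (auto simp del: one_le_exp_iff)
        then have "1 + ?S 0 \<le> D" by (simp add: D_def)
        then show ?thesis by linarith
      qed
      then show "h \<le> 1" using Sj \<open>0 < D\<close> by (simp add: h_def)
      show "0 \<le> h" using S_pos[of j] \<open>0 < D\<close> by (simp add: h_def)
      have "?S j / D \<le> ?S j / (4 * exp 1)" using D' S_pos[of j] \<open>0 < D\<close> by (intro divide_left_mono) auto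
      then show "h \<le> ?S j / 4 / exp 1" by (simp add: h_def)
    qed
    have "K * N i \<le> (real C / D) ^ d * N i"
    proof (rule mult_right_mono)
      have "1 + \<bar>K\<bar> \<le> real C / D" using C_ge \<open>0 < D\<close> by (simp add: field_simps)
      then show "K \<le> (real C / D) ^ d" using power_ge[of "real C / D"] by linarith
    qed (use Npos[of i] in simp)
    also have "\<dots> < b * h ^ d / real j ^ d"
    proof -
      have "real C ^ d * N i / D ^ d < b * (?S j / real j) ^ d / D ^ d"
        using viol' \<open>0 < D\<close> by (intro divide_strict_right_mono) auto
      then show ?thesis by (simp add: h_def power_divide mult_ac)
    qed
    also have "\<dots> \<le> b * h ^ d / fact d"
    proof (rule divide_left_mono)
      have "fact d \<le> real d ^ d" using fact_le_power[of d, where 'a = real] by simp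
      also have "\<dots> \<le> real j ^ d" using d by (intro power_mono) auto
      finally show "fact d \<le> real j ^ d" .
    qed (use h \<open>0 < b\<close> j in auto)
    finally have "K * N i < b * h ^ d / fact d" .
    moreover have "h \<le> (\<Sum>l\<in>{j<..j + m}. 1 / ?\<nu> l) / exp 1"
      unfolding partial_tail_sum
      using h(3) m by (intro order_trans[OF h(3)] divide_right_mono) auto
    ultimately show ?thesis
      using \<open>J \<le> j\<close> j h 
      by (intro exI[of _ j] exI[of _ "j + m"] exI[of _ i] exI[of _ h] conjI) (auto simp: b_def d_def)
  qed
qed

text \<open>In the quasianalytic case \<open>h = 1\<close> is always admissible because the tails diverge, and
  \<open>(M\<^sub>j / j!)\<^bsup>1/j\<^esup> \<rightarrow> \<infinity>\<close> provides the large coefficient at order \<open>0\<close>.\<close>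

lemma quasianalytic_large_coefficient:
  assumes M: "weight_sequence M" and N: "weight_sequence N"
    and growth: "filterlim (\<lambda>j. (M j / fact j) powr (1 / real j)) at_top sequentially" and "s \<ge> 1"
    and not_summable: "\<not> summable (\<lambda>l. 1 / quotients N l)"
  shows "\<exists>j\<ge>J. \<exists>n\<ge>j. \<exists>i\<le>j. \<exists>h. 0 \<le> h \<and> h \<le> 1 \<and>
     h \<le> (\<Sum>l\<in>{j<..n}. 1 / quotients N l) / exp 1 \<and>
     K * N i < M j / real s ^ j * h ^ (j - i) / fact (j - i)"
proof -
  note Mpos = weight_sequence_quotients(4)[OF M]
  note \<nu>_pos = weight_sequence_quotients(2)[OF N]
  let ?\<nu> = "quotients N"
  have "eventually (\<lambda>j. real s * (1 + \<bar>K\<bar>) \<le> (M j / fact j) powr (1 / real j)) sequentially"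
    using growth by (auto simp: filterlim_at_top)
  then obtain j where j: "j \<ge> Suc J" "real s * (1 + \<bar>K\<bar>) \<le> (M j / fact j) powr (1 / real j)"
    unfolding eventually_sequentially by (meson nat_le_linear)
  have "(real s * (1 + \<bar>K\<bar>)) ^ j \<le> ((M j / fact j) powr (1 / real j)) ^ j"
    using j \<open>s \<ge> 1\<close> by (intro power_mono) auto
  also have "\<dots> = M j / fact j"
    using Mpos[of j] j(1) by (simp add: powr_powr flip: powr_realpow)
  finally have "(1 + \<bar>K\<bar>) ^ j \<le> M j / real s ^ j / fact j"
    using \<open>s \<ge> 1\<close> unfolding power_mult_distrib by (simp add: pos_le_divide_eq mult_ac)
  moreover have "(1 + \<bar>K\<bar>) ^ 1 \<le> (1 + \<bar>K\<bar>) ^ j" using j by (intro power_increasing) auto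
  ultimately have "K < M j / real s ^ j / fact j" by simp
  have "\<not> summable (\<lambda>k. 1 / ?\<nu> (Suc j + k))"
    using not_summable summable_iff_shift[of "\<lambda>l. 1 / ?\<nu> l" "Suc j"] by (simp add: add.commute)
  then have "\<not> (\<forall>m. (\<Sum>k<m. 1 / ?\<nu> (Suc j + k)) \<le> exp 1)"
    using \<nu>_pos by (metis (no_types, lifting) less_imp_le summableI_nonneg_bounded zero_less_divide_1_iff)
  then obtain m where "exp 1 < (\<Sum>k<m. 1 / ?\<nu> (Suc j + k))" by (auto simp: not_le)
  then have "1 \<le> (\<Sum>l\<in>{j<..j + m}. 1 / ?\<nu> l) / exp 1" unfolding partial_tail_sum by simp
  moreover have "N 0 = 1" using N by (simp add: weight_sequence_def)
  ultimately show ?thesis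
    using \<open>K < M j / real s ^ j / fact j\<close> j
    by (intro exI[of _ j] exI[of _ "j + m"] exI[of _ "0::nat"] exI[of _ "1::real"] conjI) auto
qed

lemma nth_deriv_Re_tower:
  assumes "smooth f" shows "derivative_tower (\<lambda>k t. Re (nth_deriv k f t))"
  using derivative_tower_nth_deriv[OF assms]
  unfolding derivative_tower_def by (auto intro: bounded_linear.has_vector_derivative[OF bounded_linear_Re])

lemma Beurling_functionsD:
  assumes "f \<in> Beurling_functions \<NN>" "compact K" "r > 0" "x > 0"
  shows "bdd_above ((\<lambda>(t, k). norm (nth_deriv k f t) / (r ^ k * \<NN> x k)) ` (K \<times> UNIV))"
  using assms unfolding Beurling_functions_def by simp

text \<open>Assume that \<open>y\<close> admits no \<open>x\<close>. The sequence \<open>a\<close> below is supported on indices \<open>j m\<close> with gaps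
  up to \<open>n m\<close> and takes there the values \<open>b m (j m)\<close>. It belongs to \<open>\<Lambda>\<^bsup>(\<MM>)\<^esup>\<close> because both
  the matrix parameter and the geometric factor \<open>1 / (m + 1)\<close> tend to \<open>0\<close>. A function \<open>f\<close> with
  this jet would satisfy \<open>taylor_coefficient_bound\<close> at every \<open>j m\<close> with one constant, whereas the
  violation at \<open>j m\<close> has constant \<open>m\<close>.\<close>

lemma Beurling_inclusion_imp_prec_SV:
  assumes M: "weight_matrix \<MM>" and N: "weight_matrix \<NN>"
    and incl: "Beurling_sequences \<MM> \<subseteq> borel_map ` Beurling_functions \<NN>" and "y > 0"
  shows "\<exists>x>0. \<MM> x \<prec>\<^sub>S\<^sub>V \<NN> y"
proof (rule ccontr)
  assume none: "\<not> (\<exists>x>0. \<MM> x \<prec>\<^sub>S\<^sub>V \<NN> y)"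
  let ?N = "\<NN> y"
  have N_weight: "weight_sequence ?N" using N \<open>y > 0\<close> by (simp add: weight_matrix_def)
  note \<nu>_mono = weight_sequence_quotients(1)[OF N_weight]
    and \<nu>_pos = weight_sequence_quotients(2)[OF N_weight]
    and N_prod = weight_sequence_quotients(3)[OF N_weight]
  have M_weight: "weight_sequence (\<MM> x)" if "x > 0" for x using M that by (simp add: weight_matrix_def)
  define b where "b m j = \<MM> (1 / real (Suc m)) j / real (Suc m) ^ j" for m j
  have b_pos: "0 < b m j" for m j
    using weight_sequence_quotients(4)[OF M_weight, of "1 / real (Suc m)"] by (simp add: b_def)
  \<comment> \<open>\<open>fst p\<close> is the index of the coefficient and \<open>snd p\<close> the end of the gap that it requires.\<close>
  define bad where "bad m p \<longleftrightarrow> fst p \<le> snd p \<and> (\<exists>i\<le>fst p. \<exists>h. 0 \<le> h \<and> h \<le> 1 \<and>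
     h \<le> (\<Sum>l\<in>{fst p<..snd p}. 1 / quotients ?N l) / exp 1 \<and>
     real m * ?N i < b m (fst p) * h ^ (fst p - i) / fact (fst p - i))" for m and p :: "nat \<times> nat"
  have bad: "\<exists>p. bad m p \<and> J \<le> fst p" for m J
  proof -
    have "\<exists>j\<ge>J. \<exists>n\<ge>j. \<exists>i\<le>j. \<exists>h. 0 \<le> h \<and> h \<le> 1 \<and>
       h \<le> (\<Sum>l\<in>{j<..n}. 1 / quotients ?N l) / exp 1 \<and>
       real m * ?N i < \<MM> (1 / real (Suc m)) j / real (Suc m) ^ j * h ^ (j - i) / fact (j - i)"
    proof (cases "summable (\<lambda>l. 1 / quotients ?N l)")
      case True
      then show ?thesis using none by (intro not_prec_SV_large_coefficient M_weight N_weight) auto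
    next
      case False
      then show ?thesis using M 
        by (intro quasianalytic_large_coefficient M_weight N_weight) (auto simp: weight_matrix_def)
    qed
    then obtain j n i h where *: "j \<ge> J" "n \<ge> j" "i \<le> j" "0 \<le> h" "h \<le> 1"
       "h \<le> (\<Sum>l\<in>{j<..n}. 1 / quotients ?N l) / exp 1"
       "real m * ?N i < \<MM> (1 / real (Suc m)) j / real (Suc m) ^ j * h ^ (j - i) / fact (j - i)"
      by blast
    then have "bad m (j, n)" unfolding bad_def b_def by auto
    with *(1) show ?thesis by (intro exI[of _ "(j, n)"]) simp
  qed
  have "\<exists>p. \<forall>m. bad m (p m) \<and> Suc (snd (p m)) \<le> fst (p (Suc m))"
  proof (rule dependent_nat_choice)
    show "\<exists>p. bad 0 p" using bad by blast
    show "\<exists>p'. bad (Suc m) p' \<and> Suc (snd p) \<le> fst p'" for p m using bad by blast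
  qed
  then obtain p where p: "\<And>m. bad m (p m)" "\<And>m. Suc (snd (p m)) \<le> fst (p (Suc m))" by blast
  define j where "j m = fst (p m)" for m
  define n where "n m = snd (p m)" for m
  have jn: "j m \<le> n m" "n m < j (Suc m)" for m
    using p(1)[of m] p(2)[of m] by (auto simp: j_def n_def bad_def)
  have "strict_mono j" using jn by (meson le_less_trans strict_monoI_Suc)
  then have inj: "inj j" by (rule strict_mono_imp_inj_on)
  define a where "a k = (if k \<in> range j then b (inv j k) k else 0)" for k
  have a_j: "a (j m) = b m (j m)" for m using inj by (simp add: a_def)
  have a_nonneg: "0 \<le> a k" for k using b_pos[of _ k] by (simp add: a_def less_imp_le)
  have a_gap: "a k = 0" if "j m < k" "k \<le> n m" for m k
  proof -
    have "k \<noteq> j m'" for m'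
    proof (cases "m' \<le> m")
      case True then show ?thesis using that \<open>strict_mono j\<close> by (metis not_less strict_mono_less_eq)
    next
      case False
      then have "j (Suc m) \<le> j m'" using \<open>strict_mono j\<close> by (simp add: strict_mono_less_eq)
      then show ?thesis using jn(2)[of m] that by simp
    qed
    then show ?thesis by (auto simp: a_def)
  qed
  have "(\<lambda>k. complex_of_real (a k)) \<in> Beurling_sequences \<MM>"
    unfolding Beurling_sequences_def
  proof (intro CollectI allI impI)
    fix r x :: real assume "r > 0" "x > 0"
    have Mx: "0 < \<MM> x k" for k using weight_sequence_quotients(4)[OF M_weight[OF \<open>x > 0\<close>]] .
    define v where "v k = a k / (r ^ k * \<MM> x k)" for k
    have v_nonneg: "0 \<le> v k" for k using a_nonneg Mx[of k] \<open>r > 0\<close> by (simp add: v_def)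
    obtain m0 :: nat where m0: "real m0 \<ge> 1 / r + 1 / x" using real_arch_simple by blast
    have m0': "1 / r \<le> real m0" "1 / x \<le> real m0" using m0 \<open>r > 0\<close> \<open>x > 0\<close> by (smt (verit) zero_less_divide_1_iff)+
    have "v k \<le> 1 + (\<Sum>m<m0. v (j m))" for k
    proof (cases "k \<in> range j")
      case False
      then have "v k = 0" by (simp add: v_def a_def)
      moreover have "0 \<le> (\<Sum>m<m0. v (j m))" using v_nonneg by (intro sum_nonneg) auto
      ultimately show ?thesis by simp
    next
      case True
      then obtain m where k: "k = j m" by blast
      show ?thesis
      proof (cases "m < m0")
        case True
        then have "v (j m) \<le> (\<Sum>m<m0. v (j m))" using v_nonneg 
          by (intro member_le_sum[of m "{..<m0}" "\<lambda>m. v (j m)"]) auto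
        then show ?thesis by (simp add: k)
      next
        case False
        then have m: "real m0 \<le> real (Suc m)" by simp
        have "1 / real (Suc m) \<le> x" 
          using order_trans[OF m0'(2) m] \<open>x > 0\<close> by (simp add: field_simps)
        then have "\<MM> (1 / real (Suc m)) k \<le> \<MM> x k" using M by (simp add: weight_matrix_def)
        then have "a k \<le> \<MM> x k / real (Suc m) ^ k"
          unfolding k a_j b_def by (intro divide_right_mono) auto
        also have "\<dots> \<le> \<MM> x k * r ^ k"
        proof -
          have "1 / real (Suc m) \<le> r" using order_trans[OF m0'(1) m] \<open>r > 0\<close> by (simp add: field_simps)
          then have "(1 / real (Suc m)) ^ k \<le> r ^ k" by (intro power_mono) auto
          then have "\<MM> x k * (1 / real (Suc m)) ^ k \<le> \<MM> x k * r ^ k"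
            using Mx[of k] by (intro mult_left_mono) auto
          then show ?thesis by (simp add: power_divide)
        qed
        finally have "v k \<le> 1" using Mx[of k] \<open>r > 0\<close> by (simp add: v_def mult.commute)
        moreover have "0 \<le> (\<Sum>m<m0. v (j m))" using v_nonneg by (intro sum_nonneg) auto
        ultimately show ?thesis by linarith
      qed
    qed
    then show "bdd_above (range (\<lambda>k. norm (complex_of_real (a k)) / (r ^ k * \<MM> x k)))"
      using a_nonneg by (intro bdd_aboveI2[of _ _ "1 + (\<Sum>m<m0. v (j m))"]) (auto simp: v_def)
  qed
  with incl have "(\<lambda>k. complex_of_real (a k)) \<in> borel_map ` Beurling_functions \<NN>" by blast
  then obtain f where f: "f \<in> Beurling_functions \<NN>" and f0: "\<And>k. nth_deriv k f 0 = complex_of_real (a k)"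
    unfolding borel_map_def image_iff by metis
  then have "smooth f" by (simp add: Beurling_functions_def)
  have "bdd_above ((\<lambda>(t, k). norm (nth_deriv k f t) / (1 ^ k * ?N k)) ` ({0..1} \<times> UNIV))"
    using f \<open>y > 0\<close> by (intro Beurling_functionsD) auto
  then obtain C where C: "norm (nth_deriv k f t) / (1 ^ k * ?N k) \<le> C" if "t \<in> {0..1}" for t k
    unfolding bdd_above_def by (auto simp: image_iff Ball_def Bex_def)
  \<comment> \<open>\<open>taylor_coefficient_bound\<close> needs a positive constant.\<close>
  define C' where "C' = \<bar>C\<bar> + 1"
  have bound: "\<bar>Re (nth_deriv k f t)\<bar> \<le> C' * partial_prod (quotients ?N) k" if "t \<in> {0..1}" for t k
  proof -
    have "0 < ?N k" by (rule weight_sequence_quotients(4)[OF N_weight])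
    have "norm (nth_deriv k f t) \<le> C * ?N k" using C[OF that, of k] \<open>0 < ?N k\<close> by (simp add: divide_le_eq)
    also have "\<dots> \<le> C' * ?N k" using \<open>0 < ?N k\<close> by (intro mult_right_mono) (auto simp: C'_def)
    finally show ?thesis unfolding N_prod using abs_Re_le_cmod order_trans by blast
  qed
  obtain m :: nat where m: "4 * C' \<le> real m" using real_arch_simple by blast
  from p(1)[of m] obtain i h where ih: "i \<le> j m" "0 \<le> h" "h \<le> 1"
    "h \<le> (\<Sum>l\<in>{j m<..n m}. 1 / quotients ?N l) / exp 1"
    "real m * ?N i < b m (j m) * h ^ (j m - i) / fact (j m - i)"
    unfolding bad_def j_def n_def by blast
  have "Re (nth_deriv (j m) f 0) * h ^ (j m - i) / fact (j m - i) \<le> 4 * C' * partial_prod (quotients ?N) i"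
  proof (rule taylor_coefficient_bound[where F = "\<lambda>k t. Re (nth_deriv k f t)" and n = "n m"])
    show "derivative_tower (\<lambda>k t. Re (nth_deriv k f t))" by (rule nth_deriv_Re_tower[OF \<open>smooth f\<close>])
    show "0 < C'" by (simp add: C'_def)
  qed (use \<nu>_mono \<nu>_pos bound ih jn a_nonneg a_gap f0 in auto)
  also have "\<dots> \<le> real m * ?N i"
    unfolding N_prod using m weight_sequence_quotients(4)[OF N_weight, of i] by (intro mult_right_mono) auto
  finally show False using ih(5) by (simp add: f0 a_j)
qed

section \<open>Cutoff functions from infinite convolutions of boxes\<close>

definition antiderivative :: "(real \<Rightarrow> real) \<Rightarrow> real \<Rightarrow> real" where
  "antiderivative f = (SOME F. \<forall>t. (F has_real_derivative f t) (at t))"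

definition diff_quot :: "real \<Rightarrow> (real \<Rightarrow> real) \<Rightarrow> real \<Rightarrow> real" where
  "diff_quot b f t = (f (t + b) - f (t - b)) / (2 * b)"

text \<open>The convolution of \<open>f\<close> with the normalized indicator function of \<open>[-b, b]\<close>. The form as a
  difference quotient of an antiderivative gives its derivative at once, and by the mean value
  theorem each value of the average is a value of \<open>f\<close> at distance less than \<open>b\<close>.\<close>

definition average :: "real \<Rightarrow> (real \<Rightarrow> real) \<Rightarrow> real \<Rightarrow> real" where
  "average b f = diff_quot b (antiderivative f)"

lemma antiderivative_deriv:
  assumes "continuous_on UNIV f"
  shows "(antiderivative f has_real_derivative f t) (at t)"
proof -
  have "\<exists>F. \<forall>x :: real. - \<infinity> < ereal x \<longrightarrow> ereal x < \<infinity> \<longrightarrow> (F has_vector_derivative f x) (at x)"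
    using assms by (intro einterval_antiderivative) (auto simp: continuous_on_eq_continuous_at)
  then have "\<exists>F. \<forall>t. (F has_real_derivative f t) (at t)"
    by (simp add: has_real_derivative_iff_has_vector_derivative)
  then have "\<forall>t. (antiderivative f has_real_derivative f t) (at t)"
    unfolding antiderivative_def by (rule someI_ex)
  then show ?thesis by blast
qed

lemma diff_quot_deriv:
  assumes "\<And>t. (f has_real_derivative f' t) (at t)"
  shows "(diff_quot b f has_real_derivative diff_quot b f' t) (at t)"
proof -
  have "((\<lambda>t. f (t + b)) has_real_derivative f' (t + b)) (at t)"
    using assms[of "t + b"] by (simp add: DERIV_shift)
  moreover have "((\<lambda>t. f (t + - b)) has_real_derivative f' (t + - b)) (at t)"
    using assms[of "t + - b"] by (rule iffD1[OF DERIV_shift])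
  ultimately have "((\<lambda>t. (f (t + b) - f (t - b)) / (2 * b)) has_real_derivative
      (f' (t + b) - f' (t - b)) / (2 * b)) (at t)"
    by (intro DERIV_cdivide DERIV_diff) simp_all
  then show ?thesis by (simp add: diff_quot_def[abs_def])
qed

lemma average_deriv:
  assumes "continuous_on UNIV f"
  shows "(average b f has_real_derivative diff_quot b f t) (at t)"
  unfolding average_def by (rule diff_quot_deriv) (rule antiderivative_deriv[OF assms])

lemma continuous_average:
  assumes "continuous_on UNIV f" shows "continuous_on UNIV (average b f)"
  by (rule DERIV_continuous_on) (rule has_field_derivative_at_within[OF average_deriv[OF assms]])

text \<open>In particular \<open>average b\<close> is a contraction for the supremum norm.\<close>

lemma average_diff_eq:
  assumes f: "continuous_on UNIV f" and g: "continuous_on UNIV g" and "b > 0"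
  shows "\<exists>\<xi>. \<bar>\<xi> - t\<bar> < b \<and> average b f t - average b g t = f \<xi> - g \<xi>"
proof -
  define H where "H x = antiderivative f x - antiderivative g x" for x
  have "\<exists>\<xi>. t - b < \<xi> \<and> \<xi> < t + b \<and> H (t + b) - H (t - b) = (t + b - (t - b)) * (f \<xi> - g \<xi>)"
    unfolding H_def using \<open>b > 0\<close>
    by (intro MVT2 DERIV_diff antiderivative_deriv f g) auto
  then obtain \<xi> where "t - b < \<xi>" "\<xi> < t + b" "H (t + b) - H (t - b) = 2 * b * (f \<xi> - g \<xi>)" by auto
  moreover have "average b f t - average b g t = (H (t + b) - H (t - b)) / (2 * b)"
    by (simp add: average_def diff_quot_def H_def flip: diff_divide_distrib)
  ultimately show ?thesis using \<open>b > 0\<close> by (intro exI[of _ \<xi>]) auto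
qed

lemma average_eq_value:
  assumes "continuous_on UNIV f" "b > 0"
  shows "\<exists>\<xi>. \<bar>\<xi> - t\<bar> < b \<and> average b f t = f \<xi>"
proof -
  have "\<exists>\<xi>>t - b. \<xi> < t + b \<and> antiderivative f (t + b) - antiderivative f (t - b) = (t + b - (t - b)) * f \<xi>"
    using assms(2) by (intro MVT2 antiderivative_deriv assms(1)) auto
  then obtain \<xi> where "t - b < \<xi>" "\<xi> < t + b"
    "antiderivative f (t + b) - antiderivative f (t - b) = 2 * b * f \<xi>" by auto
  then show ?thesis using assms(2) by (intro exI[of _ \<xi>]) (auto simp: average_def diff_quot_def)
qed

text \<open>The first argument of type \<open>nat\<close> counts the boxes, with widths \<open>b k, b (k + 1), \<dots>\<close>. Starting
  at a variable index \<open>k\<close> makes the limits \<open>V\<^sub>k\<close> for \<open>m \<rightarrow> \<infinity>\<close> satisfy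
  \<open>V\<^sub>k = average (b k) V\<^sub>k\<^sub>+\<^sub>1\<close>.\<close>

fun iter_average :: "(nat \<Rightarrow> real) \<Rightarrow> (real \<Rightarrow> real) \<Rightarrow> nat \<Rightarrow> nat \<Rightarrow> real \<Rightarrow> real" where
  "iter_average b u 0 k = u"
| "iter_average b u (Suc m) k = average (b k) (iter_average b u m (Suc k))"

fun iter_diff_quot :: "(nat \<Rightarrow> real) \<Rightarrow> nat \<Rightarrow> (real \<Rightarrow> real) \<Rightarrow> real \<Rightarrow> real" where
  "iter_diff_quot b 0 g = g"
| "iter_diff_quot b (Suc k) g = iter_diff_quot b k (diff_quot (b k) g)"

lemma iter_diff_quot_deriv:
  assumes "\<And>t. (g has_real_derivative g' t) (at t)"
  shows "(iter_diff_quot b k g has_real_derivative iter_diff_quot b k g' t) (at t)"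
  using assms
proof (induction k arbitrary: g g' t)
  case (Suc k)
  have "(diff_quot (b k) g has_real_derivative diff_quot (b k) g' t) (at t)" for t
    by (rule diff_quot_deriv[OF Suc.prems])
  from Suc.IH[OF this] show ?case by simp
qed simp

lemma iter_diff_quot_bound:
  assumes b: "\<And>l. b l > 0" and "\<And>t. \<bar>g t\<bar> \<le> B"
  shows "\<bar>iter_diff_quot b k g t\<bar> \<le> B * (\<Prod>l<k. 1 / b l)"
  using assms(2)
proof (induction k arbitrary: g B)
  case (Suc k)
  have "\<bar>diff_quot (b k) g t\<bar> \<le> B / b k" for t
  proof -
    have "\<bar>g (t + b k) - g (t - b k)\<bar> \<le> 2 * B" using Suc.prems[of "t + b k"] Suc.prems[of "t - b k"] by linarith
    then show ?thesis using b[of k] by (simp add: diff_quot_def abs_divide field_simps)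
  qed
  from Suc.IH[OF this] show ?case by (simp add: mult_ac)
qed simp

lemma continuous_iter_average:
  "continuous_on UNIV u \<Longrightarrow> continuous_on UNIV (iter_average b u m k)"
  by (induction m arbitrary: k) (auto intro: continuous_average)

text \<open>The \<open>m\<close>-fold average at \<open>t\<close> is a value of \<open>u\<close> at some point whose distance to \<open>t\<close> is at most the
  sum of the widths. The predicate \<open>P\<close> serves for the support, the plateau and the range.\<close>

lemma iter_average_local:
  assumes u: "continuous_on UNIV u" and b: "\<And>l. b l > 0"
    and "\<And>s. \<bar>s - t\<bar> \<le> (\<Sum>i<m. b (k + i)) \<Longrightarrow> P (u s)"
  shows "P (iter_average b u m k t)"
  using assms(3)
proof (induction m arbitrary: k t)
  case (Suc m)
  obtain \<xi> where \<xi>: "\<bar>\<xi> - t\<bar> < b k" "iter_average b u (Suc m) k t = iter_average b u m (Suc k) \<xi>"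
    using average_eq_value[OF continuous_iter_average[OF u, of b m "Suc k"] b[of k], of t] by auto
  have "P (iter_average b u m (Suc k) \<xi>)"
  proof (rule Suc.IH)
    fix s assume "\<bar>s - \<xi>\<bar> \<le> (\<Sum>i<m. b (Suc k + i))"
    then have "\<bar>s - t\<bar> \<le> b k + (\<Sum>i<m. b (Suc k + i))" using \<xi>(1) by linarith
    also have "\<dots> = (\<Sum>i<Suc m. b (k + i))" by (simp add: sum.lessThan_Suc_shift del: sum.lessThan_Suc)
    finally show "P (u s)" by (rule Suc.prems)
  qed
  then show ?case using \<xi>(2) by simp
qed simp

text \<open>Only the innermost average differs: it moves a Lipschitz function \<open>u\<close> by at most \<open>L\<close> times the
  width of the box, and the outer averages are contractions.\<close>

lemma iter_average_step:
  assumes u: "continuous_on UNIV u" and b: "\<And>l. b l > 0"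
    and lip: "\<And>s t. \<bar>u s - u t\<bar> \<le> L * \<bar>s - t\<bar>" and "L \<ge> 0"
  shows "\<bar>iter_average b u (Suc m) k t - iter_average b u m k t\<bar> \<le> L * b (k + m)"
proof (induction m arbitrary: k t)
  case 0
  obtain \<xi> where \<xi>: "\<bar>\<xi> - t\<bar> < b k" "average (b k) u t = u \<xi>"
    using average_eq_value[OF u b] by blast
  have "\<bar>u \<xi> - u t\<bar> \<le> L * b k"
    using lip[of \<xi> t] \<xi>(1) \<open>L \<ge> 0\<close> by (meson less_imp_le mult_left_mono order_trans)
  then show ?case using \<xi>(2) by simp
next
  case (Suc m)
  obtain \<xi> where "iter_average b u (Suc (Suc m)) k t - iter_average b u (Suc m) k t
      = iter_average b u (Suc m) (Suc k) \<xi> - iter_average b u m (Suc k) \<xi>"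
    using average_diff_eq[OF continuous_iter_average[OF u, of b "Suc m" "Suc k"]
        continuous_iter_average[OF u, of b m "Suc k"] b[of k], of t] by auto
  then show ?case using Suc.IH[of "Suc k" \<xi>] by (simp del: iter_average.simps)
qed

lemma iter_average_uniform_limit:
  assumes u: "continuous_on UNIV u" and b: "\<And>l. b l > 0" and "summable b"
    and lip: "\<And>s t. \<bar>u s - u t\<bar> \<le> L * \<bar>s - t\<bar>" and "L \<ge> 0"
  shows "\<exists>V. uniform_limit UNIV (\<lambda>m. iter_average b u m k) V sequentially"
proof -
  let ?W = "\<lambda>m. iter_average b u m k"
  have "uniform_limit UNIV (\<lambda>n t. \<Sum>i<n. ?W (Suc i) t - ?W i t) (\<lambda>t. \<Sum>i. ?W (Suc i) t - ?W i t) sequentially"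
  proof (rule Weierstrass_m_test)
    show "norm (?W (Suc i) t - ?W i t) \<le> L * b (k + i)" for i t
      using iter_average_step[OF u b lip \<open>L \<ge> 0\<close>] by (simp del: iter_average.simps)
    show "summable (\<lambda>i. L * b (k + i))"
      using \<open>summable b\<close> summable_iff_shift[of b k] by (intro summable_mult) (simp add: add.commute)
  qed
  moreover have "(\<Sum>i<n. ?W (Suc i) t - ?W i t) = ?W n t - u t" for n t
    using sum_lessThan_telescope[of "\<lambda>i. ?W i t" n] by (simp del: iter_average.simps(2))
  ultimately have "uniform_limit UNIV (\<lambda>n t. ?W n t - u t) (\<lambda>t. \<Sum>i. ?W (Suc i) t - ?W i t) sequentially"
    by (simp only:)
  from uniform_limit_add[OF uniform_limit_const[of u] this] show ?thesis by (intro exI) simp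
qed

text \<open>Let \<open>u\<close> be the trapezoid that is \<open>1\<close> on \<open>[-2R, 2R]\<close> and \<open>0\<close> off \<open>[-3R, 3R]\<close>, and let \<open>V\<^sub>k\<close> be its
  infinite average over the boxes with indices \<open>\<ge> k\<close>. The \<open>k\<close>-th derivative of \<open>V\<^sub>0\<close> consists of
  the difference quotients with widths \<open>b 0, \<dots>, b (k - 1)\<close> applied to \<open>V\<^sub>k\<close>, and each of them
  costs a factor \<open>1 / b l\<close>, starting from \<open>\<bar>V\<^sub>k\<bar> \<le> 1\<close>.\<close>

lemma exists_cutoff:
  assumes b: "\<And>l. b l > 0" and "summable b" and "suminf b \<le> R"
  shows "\<exists>U :: nat \<Rightarrow> real \<Rightarrow> real. derivative_tower U \<and> (\<forall>k t. \<bar>U k t\<bar> \<le> (\<Prod>l<k. 1 / b l)) \<and>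
     U 0 0 = 1 \<and> (\<forall>k. U (Suc k) 0 = 0) \<and> (\<forall>k t. 4 * R < \<bar>t\<bar> \<longrightarrow> U k t = 0)"
proof -
  have "0 < suminf b" using b \<open>summable b\<close> by (intro suminf_pos) auto
  then have "R > 0" using assms(3) by linarith
  define u where "u t = max 0 (min 1 (3 - \<bar>t\<bar> / R))" for t
  have u_cont: "continuous_on UNIV u" unfolding u_def using \<open>R > 0\<close> by (intro continuous_intros) auto
  have lip: "\<bar>u s - u t\<bar> \<le> (1 / R) * \<bar>s - t\<bar>" for s t
  proof -
    have "\<bar>u s - u t\<bar> \<le> \<bar>\<bar>s\<bar> / R - \<bar>t\<bar> / R\<bar>" unfolding u_def by linarith
    also have "\<dots> \<le> \<bar>s - t\<bar> / R" using \<open>R > 0\<close> by (simp add: divide_right_mono flip: diff_divide_distrib)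
    finally show ?thesis by simp
  qed
  have "\<exists>V. \<forall>k. uniform_limit UNIV (\<lambda>m. iter_average b u m k) (V k) sequentially"
    using iter_average_uniform_limit[OF u_cont b \<open>summable b\<close> lip] \<open>R > 0\<close> by (intro choice) auto
  then obtain V where V: "\<And>k. uniform_limit UNIV (\<lambda>m. iter_average b u m k) (V k) sequentially" by blast
  have V_lim: "(\<lambda>m. iter_average b u m k t) \<longlonglongrightarrow> V k t" for k t
    using tendsto_uniform_limitI[OF V] by simp
  have V_cont: "continuous_on UNIV (V k)" for k
    by (rule uniform_limit_theorem[OF _ V]) (auto intro!: always_eventually continuous_iter_average u_cont)
  have V_eq: "V k = average (b k) (V (Suc k))" for k
  proof
    fix t
    have "(\<lambda>m. iter_average b u (Suc m) k t) \<longlonglongrightarrow> average (b k) (V (Suc k)) t"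
    proof (rule metric_LIMSEQ_I)
      fix e :: real assume "e > 0"
      then have "eventually (\<lambda>m. \<forall>x\<in>UNIV. dist (iter_average b u m (Suc k) x) (V (Suc k) x) < e) sequentially"
        using V[of "Suc k"] by (simp add: uniform_limit_iff)
      then obtain m0 where m0: "\<And>m x. m \<ge> m0 \<Longrightarrow> dist (iter_average b u m (Suc k) x) (V (Suc k) x) < e"
        unfolding eventually_sequentially by blast
      have "dist (iter_average b u (Suc m) k t) (average (b k) (V (Suc k)) t) < e" if "m \<ge> m0" for m
      proof -
        obtain \<xi> where "average (b k) (iter_average b u m (Suc k)) t - average (b k) (V (Suc k)) t
            = iter_average b u m (Suc k) \<xi> - V (Suc k) \<xi>"
          using average_diff_eq[OF continuous_iter_average[OF u_cont] V_cont b] by blast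
        then show ?thesis using m0[OF that, of \<xi>] by (simp add: dist_real_def)
      qed
      then show "\<exists>m0. \<forall>m\<ge>m0. dist (iter_average b u (Suc m) k t) (average (b k) (V (Suc k)) t) < e" by blast
    qed
    moreover have "(\<lambda>m. iter_average b u (Suc m) k t) \<longlonglongrightarrow> V k t"
      using V_lim[of k t] by (rule LIMSEQ_Suc)
    ultimately show "V k t = average (b k) (V (Suc k)) t" by (rule LIMSEQ_unique[rotated])
  qed
  have V_local: "P (V k t)" if "closed (Collect P)" "\<And>s. \<bar>s - t\<bar> \<le> R \<Longrightarrow> P (u s)" for P k t
  proof -
    have "P (iter_average b u m k t)" for m
    proof (rule iter_average_local[OF u_cont b])
      fix s assume "\<bar>s - t\<bar> \<le> (\<Sum>i<m. b (k + i))"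
      also have "\<dots> \<le> (\<Sum>i<k + m. b i)"
      proof -
        have "(\<Sum>i<m. b (k + i)) = sum b {k..<k + m}"
          by (rule sum.reindex_bij_witness[of _ "\<lambda>i. i - k" "\<lambda>i. k + i"]) auto
        also have "\<dots> \<le> sum b {..<k + m}" using b by (intro sum_mono2) (auto simp: less_imp_le)
        finally show ?thesis .
      qed
      also have "\<dots> \<le> suminf b" using b \<open>summable b\<close> by (intro sum_le_suminf) (auto simp: less_imp_le)
      also have "\<dots> \<le> R" by fact
      finally show "P (u s)" by (rule that(2))
    qed
    then have "V k t \<in> Collect P"
      by (intro closed_sequentially[OF that(1) _ V_lim]) simp
    then show ?thesis by simp
  qed
  have V_bound: "\<bar>V k t\<bar> \<le> 1" for k t
  proof (rule V_local[of "\<lambda>x. \<bar>x\<bar> \<le> 1"])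
    show "closed {x :: real. \<bar>x\<bar> \<le> 1}" by (intro closed_Collect_le continuous_intros)
  qed (auto simp: u_def)
  have V_one: "V k t = 1" if "\<bar>t\<bar> < R" for k t
  proof (rule V_local[of "\<lambda>x. x = 1"])
    fix s assume "\<bar>s - t\<bar> \<le> R"
    then have "\<bar>s\<bar> / R \<le> 2" using that \<open>R > 0\<close> by (simp add: divide_le_eq)
    then show "u s = 1" by (simp add: u_def)
  qed simp
  have V_zero: "V k t = 0" if "4 * R < \<bar>t\<bar>" for k t
  proof (rule V_local[of "\<lambda>x. x = 0"])
    fix s assume "\<bar>s - t\<bar> \<le> R"
    then have "\<bar>s\<bar> / R \<ge> 3" using that \<open>R > 0\<close> by (simp add: le_divide_eq)
    then show "u s = 0" by (simp add: u_def)
  qed simp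
  define U where "U k = iter_diff_quot b k (V k)" for k
  have U: "derivative_tower U"
    unfolding derivative_tower_real_iff
  proof (intro allI)
    fix k t
    have "(V k has_real_derivative diff_quot (b k) (V (Suc k)) t) (at t)" for t
      unfolding V_eq[of k] by (rule average_deriv[OF V_cont])
    from iter_diff_quot_deriv[OF this] show "(U k has_real_derivative U (Suc k) t) (at t)"
      by (simp add: U_def)
  qed
  have U0: "U 0 t = V 0 t" for t by (simp add: U_def)
  have "U (Suc k) 0 = 0" for k
    using V_one \<open>R > 0\<close> by (intro derivative_tower_locally_constant[OF U, of "{-R<..<R}" 1]) (auto simp: U0)
  moreover have "U k t = 0" if "4 * R < \<bar>t\<bar>" for k t
  proof (cases k)
    case 0 then show ?thesis using V_zero[OF that] by (simp add: U0)
  next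
    case (Suc k')
    have "open {t. 4 * R < \<bar>t\<bar>}" by (intro open_Collect_less continuous_intros)
    then show ?thesis unfolding Suc
      using V_zero that by (intro derivative_tower_locally_constant[OF U, of "{t. 4 * R < \<bar>t\<bar>}" 0]) (auto simp: U0)
  qed
  moreover have "\<bar>U k t\<bar> \<le> (\<Prod>l<k. 1 / b l)" for k t
    using iter_diff_quot_bound[OF b V_bound] by (simp add: U_def)
  moreover have "U 0 0 = 1" using V_one \<open>R > 0\<close> by (simp add: U0)
  ultimately show ?thesis using U by blast
qed

section \<open>Functions with a prescribed jet\<close>

lemma prod_lessThan_add:
  "(\<Prod>l<q + p. f l) = (\<Prod>l<q. f l) * (\<Prod>l<p. f (q + l))" for f :: "nat \<Rightarrow> real"
  by (induction p) (auto simp: mult_ac)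

text \<open>The widths for the cutoff of the monomial of degree \<open>j\<close>. The first \<open>j\<close> boxes are wider than
  both \<open>S\<^sub>j / j\<close> and \<open>1 / \<nu>\<^sub>j\<^sub>+\<^sub>l\<close> (counting \<open>l\<close> from \<open>1\<close>), so that either
  bound may be used for the corresponding factor of the derivative. The remaining boxes have
  widths \<open>1 / \<nu>\<^sub>l\<close>, not \<open>1 / \<nu>\<^sub>j\<^sub>+\<^sub>l\<close>: multiplication by \<open>t\<^sup>j\<close> lets up to \<open>j\<close>
  additional derivatives fall on the cutoff.\<close>

definition box_widths :: "(nat \<Rightarrow> real) \<Rightarrow> nat \<Rightarrow> nat \<Rightarrow> real" where
  "box_widths \<nu> j l =
    (if l < j then tail_sum \<nu> j / real j + 1 / \<nu> (j + Suc l) else 1 / \<nu> (Suc l))"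

lemma box_widths_pos:
  assumes "summable (\<lambda>l. 1 / \<nu> l)" "\<And>l. 0 < \<nu> l"
  shows "0 < box_widths \<nu> j l"
proof (cases "l < j")
  case True
  then have "0 < tail_sum \<nu> j / real j" "0 < 1 / \<nu> (j + Suc l)"
    using tail_sum_pos[OF assms, of j] assms(2)[of "j + Suc l"] by auto
  with True show ?thesis unfolding box_widths_def by (simp only: if_True add_pos_pos)
next
  case False
  then show ?thesis using assms(2)[of "Suc l"] by (simp add: box_widths_def)
qed

lemma box_widths_sum:
  assumes \<nu>: "summable (\<lambda>l. 1 / \<nu> l)" "\<And>l. 0 < \<nu> l"
  shows "summable (box_widths \<nu> j)" "suminf (box_widths \<nu> j) \<le> 3 * tail_sum \<nu> j"
proof -
  have shift: "(\<lambda>n. box_widths \<nu> j (n + j)) = (\<lambda>n. 1 / \<nu> (Suc j + n))"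
    by (auto simp: box_widths_def add.commute)
  have "summable (\<lambda>n. box_widths \<nu> j (n + j))" unfolding shift by (rule summable_tail[OF \<nu>(1)])
  then show s: "summable (box_widths \<nu> j)" by (simp only: summable_iff_shift)
  have "suminf (box_widths \<nu> j) = tail_sum \<nu> (Suc j) + (\<Sum>l<j. box_widths \<nu> j l)"
    unfolding suminf_split_initial_segment[OF s, of j] shift tail_sum_def ..
  also have "(\<Sum>l<j. box_widths \<nu> j l) = (\<Sum>l<j. tail_sum \<nu> j / real j) + (\<Sum>l<j. 1 / \<nu> (j + Suc l))"
    unfolding sum.distrib[symmetric] by (intro sum.cong) (auto simp: box_widths_def)
  also have "(\<Sum>l<j. tail_sum \<nu> j / real j) \<le> tail_sum \<nu> j"
    using tail_sum_pos[OF \<nu>, of j] by (cases "j = 0") auto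
  also have "(\<Sum>l<j. 1 / \<nu> (j + Suc l)) \<le> tail_sum \<nu> (Suc j)"
    unfolding tail_sum_def using \<nu>(2) summable_tail[OF \<nu>(1), of "Suc j"]
    by (simp add: sum_le_suminf less_imp_le)
  also have "tail_sum \<nu> (Suc j) \<le> tail_sum \<nu> j" by (rule tail_sum_antimono[OF \<nu>]) simp
  finally show "suminf (box_widths \<nu> j) \<le> 3 * tail_sum \<nu> j" by simp
qed

lemma box_widths_inverse_le:
  assumes \<nu>: "summable (\<lambda>l. 1 / \<nu> l)" "\<And>l. 0 < \<nu> l" and "l < j"
  shows "1 / box_widths \<nu> j l \<le> real j / tail_sum \<nu> j" "1 / box_widths \<nu> j l \<le> \<nu> (j + Suc l)"
proof -
  have a: "0 < tail_sum \<nu> j / real j" using tail_sum_pos[OF \<nu>, of j] \<open>l < j\<close> by simp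
  have b: "0 < 1 / \<nu> (j + Suc l)" using \<nu>(2)[of "j + Suc l"] by simp
  have le: "1 / (x + y) \<le> 1 / x" if "0 < x" "0 < y" for x y :: real
    using that by (simp add: field_simps)
  have w: "box_widths \<nu> j l = tail_sum \<nu> j / real j + 1 / \<nu> (j + Suc l)"
    using \<open>l < j\<close> by (simp add: box_widths_def)
  show "1 / box_widths \<nu> j l \<le> real j / tail_sum \<nu> j"
    using le[OF a b] unfolding w by simp
  show "1 / box_widths \<nu> j l \<le> \<nu> (j + Suc l)"
    using le[OF b a] unfolding w by (simp add: add.commute)
qed

lemma prod_box_widths_low:
  assumes \<nu>: "summable (\<lambda>l. 1 / \<nu> l)" "\<And>l. 0 < \<nu> l" and "i \<le> j"
  shows "(\<Prod>l<i. 1 / box_widths \<nu> j l) \<le> (real j / tail_sum \<nu> j) ^ i"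
proof -
  have "(\<Prod>l<i. 1 / box_widths \<nu> j l) \<le> (\<Prod>l<i. real j / tail_sum \<nu> j)"
    using box_widths_inverse_le(1)[OF \<nu>] box_widths_pos[OF \<nu>] \<open>i \<le> j\<close>
    by (intro prod_mono) (auto simp: less_imp_le)
  then show ?thesis by simp
qed

text \<open>A derivative of order \<open>q + p\<close> of the cutoff. Among the first \<open>j\<close> factors, \<open>p\<close> are estimated by
  \<open>j / S\<^sub>j\<close>. The other \<open>q\<close> factors are estimated by quotients whose indices may be raised to
  the range from \<open>j + 1\<close> to \<open>j + q\<close>.\<close>

lemma prod_box_widths_high:
  assumes \<nu>: "mono \<nu>" "summable (\<lambda>l. 1 / \<nu> l)" "\<And>l. 0 < \<nu> l" and "p \<le> j"
  shows "(\<Prod>l<q + p. 1 / box_widths \<nu> j l)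
     \<le> (real j / tail_sum \<nu> j) ^ p * (partial_prod \<nu> (j + q) / partial_prod \<nu> j)"
proof -
  let ?f = "\<lambda>l. 1 / box_widths \<nu> j l" and ?r = "real j / tail_sum \<nu> j"
  have f_pos: "0 \<le> ?f l" for l using box_widths_pos[OF \<nu>(2,3), of j l] by simp
  have \<nu>_nonneg: "0 \<le> \<nu> l" for l using \<nu>(3)[of l] by simp
  have r_nonneg: "0 \<le> ?r" using tail_sum_pos[OF \<nu>(2,3), of j] by simp
  have ratio: "partial_prod \<nu> (j + q) / partial_prod \<nu> j = (\<Prod>l<q. \<nu> (j + Suc l))"
    using partial_prod_pos[of \<nu> j] \<nu>(3) unfolding partial_prod_add by (simp add: less_imp_neq[symmetric])
  have middle: "(\<Prod>l<p. ?f (m + l)) \<le> ?r ^ p" if "m + p \<le> j" for m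
  proof -
    have "(\<Prod>l<p. ?f (m + l)) \<le> (\<Prod>l<p. ?r)"
      using box_widths_inverse_le(1)[OF \<nu>(2,3)] f_pos that by (intro prod_mono) auto
    then show ?thesis by simp
  qed
  show ?thesis unfolding ratio
  proof (cases "q + p \<le> j")
    case True
    have "(\<Prod>l<q. ?f l) \<le> (\<Prod>l<q. \<nu> (j + Suc l))"
      using box_widths_inverse_le(2)[OF \<nu>(2,3)] f_pos True by (intro prod_mono) auto
    then have "(\<Prod>l<q. ?f l) * (\<Prod>l<p. ?f (q + l)) \<le> (\<Prod>l<q. \<nu> (j + Suc l)) * ?r ^ p"
      using f_pos \<nu>_nonneg by (intro mult_mono middle[OF True] prod_nonneg) auto
    then show "(\<Prod>l<q + p. ?f l) \<le> ?r ^ p * (\<Prod>l<q. \<nu> (j + Suc l))"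
      by (simp only: prod_lessThan_add mult.commute)
  next
    case False
    define m where "m = j - p"
    define d where "d = q + p - j"
    have md: "j = m + p" "q = d + m" using False \<open>p \<le> j\<close> by (auto simp: m_def d_def)
    have "(\<Prod>l<m. ?f l) \<le> (\<Prod>l<m. \<nu> (j + Suc (d + l)))"
    proof (rule prod_mono)
      fix l assume "l \<in> {..<m}"
      then have "?f l \<le> \<nu> (j + Suc l)" by (intro box_widths_inverse_le(2)[OF \<nu>(2,3)]) (simp add: md)
      also have "\<dots> \<le> \<nu> (j + Suc (d + l))" using \<nu>(1) by (rule monoD) simp
      finally show "0 \<le> ?f l \<and> ?f l \<le> \<nu> (j + Suc (d + l))" using f_pos by simp
    qed
    moreover have "(\<Prod>l<p. ?f (m + l)) \<le> ?r ^ p" by (rule middle) (simp add: md)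
    moreover have "(\<Prod>l<d. ?f (j + l)) = (\<Prod>l<d. \<nu> (j + Suc l))"
      by (intro prod.cong) (auto simp: box_widths_def)
    moreover have "(\<Prod>l<q + p. ?f l) = (\<Prod>l<m. ?f l) * (\<Prod>l<p. ?f (m + l)) * (\<Prod>l<d. ?f (j + l))"
    proof -
      have "q + p = j + d" using md by linarith
      then have "(\<Prod>l<q + p. ?f l) = (\<Prod>l<j. ?f l) * (\<Prod>l<d. ?f (j + l))"
        by (simp only: prod_lessThan_add)
      moreover have "(\<Prod>l<j. ?f l) = (\<Prod>l<m. ?f l) * (\<Prod>l<p. ?f (m + l))"
        using prod_lessThan_add[of ?f m p] by (simp only: md(1)[symmetric])
      ultimately show ?thesis by (simp only:)
    qed
    moreover have "(\<Prod>l<q. \<nu> (j + Suc l)) = (\<Prod>l<d. \<nu> (j + Suc l)) * (\<Prod>l<m. \<nu> (j + Suc (d + l)))"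
      unfolding md(2) prod_lessThan_add ..
    ultimately have "(\<Prod>l<q + p. ?f l)
        \<le> (\<Prod>l<m. \<nu> (j + Suc (d + l))) * ?r ^ p * (\<Prod>l<d. \<nu> (j + Suc l))"
      using f_pos \<nu>_nonneg r_nonneg 
      by (simp only:) (intro mult_mono order_refl prod_nonneg mult_nonneg_nonneg zero_le_power; blast)
    then show "(\<Prod>l<q + p. ?f l) \<le> ?r ^ p * (\<Prod>l<q. \<nu> (j + Suc l))"
      unfolding md(2) prod_lessThan_add[of _ d m] by (simp only: mult_ac)
  qed
qed

text \<open>This combines the size of \<open>t\<^sup>p / p!\<close> on the support of the cutoff, of radius \<open>12 a\<close>, with the
  \<open>p\<close> factors \<open>j / a\<close>; it rests on \<open>j\<^sup>p / p! \<le> e\<^sup>j \<le> 3\<^sup>j\<close>.\<close>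

lemma scaled_power_div_fact_le:
  assumes "0 < a" "1 \<le> j" "p \<le> j"
  shows "(12 * a) ^ p / fact p * (real j / a) ^ p \<le> 36 ^ j"
proof -
  have "(12 * a) ^ p / fact p * (real j / a) ^ p = 12 ^ p * (real j ^ p / fact p)"
    using assms by (simp add: power_mult_distrib power_divide)
  also have "\<dots> \<le> 12 ^ j * 3 ^ j"
  proof (rule mult_mono)
    have "real j ^ p / fact p \<le> (\<Sum>i<Suc p. real j ^ i / fact i)"
      by (rule member_le_sum) auto
    also have "\<dots> \<le> exp (real j)" by (rule sum_power_div_fact_le_exp) simp
    also have "\<dots> = exp 1 ^ j" by (simp flip: exp_of_nat_mult)
    also have "\<dots> \<le> 3 ^ j" using exp_le by (intro power_mono) auto
    finally show "real j ^ p / fact p \<le> 3 ^ j" .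
  qed (use assms in \<open>auto intro: power_increasing\<close>)
  also have "\<dots> = 36 ^ j" by (simp flip: power_mult_distrib)
  finally show ?thesis .
qed

text \<open>A single summand of the Leibniz formula. The monomial contributes a power of exponent
  \<open>p = j - (k - i)\<close>. For \<open>k \<le> j\<close> the hypothesis is applied at the order \<open>k\<close>, for \<open>k > j\<close> at the order
  \<open>j\<close>; in the latter case the missing quotients between \<open>N\<^sub>j\<close> and \<open>N\<^sub>k\<close> come from the cutoff.\<close>

lemma adapted_monomial_bound:
  assumes \<nu>: "mono \<nu>" "summable (\<lambda>l. 1 / \<nu> l)" "\<And>l. 0 < \<nu> l" and "1 \<le> j"
    and H: "\<And>i. i \<le> j \<Longrightarrow> \<bar>c\<bar> * (tail_sum \<nu> j / real j) ^ (j - i) \<le> B * partial_prod \<nu> i"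
    and i: "i \<le> k" "k - i \<le> j" and t: "\<bar>t\<bar> \<le> 12 * tail_sum \<nu> j"
  shows "\<bar>c\<bar> * ((\<Prod>l<i. 1 / box_widths \<nu> j l) * \<bar>monomial_tower j (k - i) t\<bar>)
     \<le> B * 36 ^ j * partial_prod \<nu> k"
proof -
  let ?a = "tail_sum \<nu> j" and ?N = "partial_prod \<nu>"
  have a: "0 < ?a" by (rule tail_sum_pos[OF \<nu>(2,3)])
  have Npos: "0 < ?N k" for k using \<nu>(3) by (rule partial_prod_pos)
  define p where "p = j - (k - i)"
  have p: "p \<le> j" "j + i = p + k" using i by (auto simp: p_def)
  define E where "E = (12 * ?a) ^ p / fact p * (real j / ?a) ^ p"
  have E: "0 \<le> E" "E \<le> 36 ^ j" using scaled_power_div_fact_le[OF a \<open>1 \<le> j\<close> p(1)] a by (auto simp: E_def)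
  have mono_le: "\<bar>monomial_tower j (k - i) t\<bar> \<le> (12 * ?a) ^ p / fact p"
  proof -
    have "\<bar>monomial_tower j (k - i) t\<bar> = \<bar>t\<bar> ^ p / fact p"
      using i by (simp add: monomial_tower_def p_def power_abs)
    also have "\<dots> \<le> (12 * ?a) ^ p / fact p"
      using t by (intro divide_right_mono power_mono) auto
    finally show ?thesis .
  qed
  obtain y where y: "(\<Prod>l<i. 1 / box_widths \<nu> j l) \<le> (real j / ?a) ^ p * y"
    and y': "\<bar>c\<bar> * y \<le> B * ?N k" and "0 \<le> y"
  proof (cases "k \<le> j")
    case True
    have "(real j / ?a) ^ p * (?a / real j) ^ (j - k) = (real j / ?a) ^ i"
    proof -
      have "p = i + (j - k)" using p True by simp
      then show ?thesis using a \<open>1 \<le> j\<close> by (simp add: power_add flip: power_mult_distrib)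
    qed
    then have "(\<Prod>l<i. 1 / box_widths \<nu> j l) \<le> (real j / ?a) ^ p * (?a / real j) ^ (j - k)"
      using prod_box_widths_low[OF \<nu>(2,3), of i j] i True by simp
    then show ?thesis using that H[OF True] a by simp
  next
    case False
    define q where "q = k - j"
    have q: "i = q + p" "k = j + q" using False p by (auto simp: q_def)
    have "\<bar>c\<bar> \<le> B * ?N j" using H[of j] by simp
    then have "\<bar>c\<bar> * (?N k / ?N j) \<le> B * ?N j * (?N k / ?N j)"
      using Npos[of k] Npos[of j] by (intro mult_right_mono) auto
    also have "\<dots> = B * ?N k" using Npos[of j] by simp
    finally show ?thesis
      using prod_box_widths_high[OF \<nu> p(1), of q] Npos[of k] Npos[of j]
      by (intro that[of "?N k / ?N j"]) (auto simp only: q intro!: divide_pos_pos less_imp_le)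
  qed
  have "\<bar>c\<bar> * ((\<Prod>l<i. 1 / box_widths \<nu> j l) * \<bar>monomial_tower j (k - i) t\<bar>)
      \<le> \<bar>c\<bar> * (((real j / ?a) ^ p * y) * ((12 * ?a) ^ p / fact p))"
    using y mono_le a \<open>0 \<le> y\<close> by (intro mult_left_mono mult_mono) auto
  also have "\<dots> = E * (\<bar>c\<bar> * y)" by (simp add: E_def)
  also have "\<dots> \<le> 36 ^ j * (B * ?N k)" using E \<open>0 \<le> y\<close> by (intro mult_mono[OF E(2) y']) auto
  finally show ?thesis by (simp add: mult_ac)
qed

lemma exists_adapted_monomial:
  assumes \<nu>: "mono \<nu>" "summable (\<lambda>l. 1 / \<nu> l)" "\<And>l. 0 < \<nu> l" and "1 \<le> j" and "0 \<le> B"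
    and H: "\<And>i. i \<le> j \<Longrightarrow> \<bar>c\<bar> * (tail_sum \<nu> j / real j) ^ (j - i) \<le> B * partial_prod \<nu> i"
  shows "\<exists>G :: nat \<Rightarrow> real \<Rightarrow> real. derivative_tower G \<and> (\<forall>k. G k 0 = (if k = j then c else 0)) \<and>
     (\<forall>k t. \<bar>G k t\<bar> \<le> B * 36 ^ j * (2 ^ k * partial_prod \<nu> k))"
proof -
  let ?P = "monomial_tower j"
  obtain U :: "nat \<Rightarrow> real \<Rightarrow> real" where U: "derivative_tower U"
    and U_bound: "\<And>k t. \<bar>U k t\<bar> \<le> (\<Prod>l<k. 1 / box_widths \<nu> j l)"
    and U_0: "U 0 0 = 1" "\<And>k. U (Suc k) 0 = 0"
    and U_supp: "\<And>k t. 4 * (3 * tail_sum \<nu> j) < \<bar>t\<bar> \<Longrightarrow> U k t = 0"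
    using exists_cutoff[OF box_widths_pos[OF \<nu>(2,3)] box_widths_sum[OF \<nu>(2,3)]] by blast
  define T where "T k t = (\<Sum>i\<le>k. real (k choose i) * (U i t * ?P (k - i) t))" for k t
  have T: "derivative_tower T" unfolding T_def by (rule leibniz_tower[OF U derivative_tower_monomial])
  have T_0: "T k 0 = (if k = j then 1 else 0)" for k
  proof -
    have "T k 0 = (\<Sum>i\<in>{0}. real (k choose i) * (U i 0 * ?P (k - i) 0))"
      unfolding T_def
    proof (rule sum.mono_neutral_right)
      show "\<forall>i\<in>{..k} - {0}. real (k choose i) * (U i 0 * ?P (k - i) 0) = 0"
      proof
        fix i assume "i \<in> {..k} - {0}"
        then obtain i' where "i = Suc i'" by (cases i) auto
        then show "real (k choose i) * (U i 0 * ?P (k - i) 0) = 0" using U_0(2) by simp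
      qed
    qed auto
    then show ?thesis by (auto simp: U_0 monomial_tower_def)
  qed
  have bound: "\<bar>c * T k t\<bar> \<le> B * 36 ^ j * (2 ^ k * partial_prod \<nu> k)" for k t
  proof -
    let ?C = "B * 36 ^ j * partial_prod \<nu> k"
    have "0 \<le> ?C" using \<open>0 \<le> B\<close> partial_prod_pos[of \<nu> k] \<nu>(3) by (simp add: less_imp_le)
    have term_le: "\<bar>c\<bar> * \<bar>U i t * ?P (k - i) t\<bar> \<le> ?C" if "i \<le> k" for i
    proof (cases "k - i \<le> j \<and> \<bar>t\<bar> \<le> 12 * tail_sum \<nu> j")
      case True
      have "\<bar>c\<bar> * \<bar>U i t * ?P (k - i) t\<bar> 
          \<le> \<bar>c\<bar> * ((\<Prod>l<i. 1 / box_widths \<nu> j l) * \<bar>?P (k - i) t\<bar>)"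
        unfolding abs_mult using U_bound by (intro mult_left_mono mult_right_mono) auto
      also have "\<dots> \<le> ?C"
        using True that by (intro adapted_monomial_bound[OF \<nu> \<open>1 \<le> j\<close> H]) auto
      finally show ?thesis .
    next
      case False
      then have "U i t * ?P (k - i) t = 0" using U_supp[of t i] by (auto simp: monomial_tower_def)
      then show ?thesis using \<open>0 \<le> ?C\<close> by (simp only: abs_zero mult_zero_right)
    qed
    have "\<bar>c * T k t\<bar> \<le> (\<Sum>i\<le>k. \<bar>c * (real (k choose i) * (U i t * ?P (k - i) t))\<bar>)"
      unfolding T_def sum_distrib_left by (rule sum_abs)
    also have "\<dots> = (\<Sum>i\<le>k. real (k choose i) * (\<bar>c\<bar> * \<bar>U i t * ?P (k - i) t\<bar>))"
      by (intro sum.cong) (auto simp: abs_mult)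
    also have "\<dots> \<le> (\<Sum>i\<le>k. real (k choose i) * ?C)"
      using term_le by (intro sum_mono mult_left_mono) auto
    also have "\<dots> = real (\<Sum>i\<le>k. k choose i) * ?C" by (simp add: sum_distrib_right)
    also have "\<dots> = B * 36 ^ j * (2 ^ k * partial_prod \<nu> k)" unfolding choose_row_sum by simp
    finally show ?thesis .
  qed
  have "derivative_tower (\<lambda>k t. c * T k t)"
    using T unfolding derivative_tower_real_iff by (auto intro: DERIV_cmult)
  then show ?thesis
    using bound T_0 by (intro exI[of _ "\<lambda>k t. c * T k t"]) auto
qed

text \<open>The factor \<open>72\<^sup>-\<^sup>j\<close> beats the losses \<open>36\<^sup>j\<close> of \<open>adapted_monomial_bound\<close>, so that the series and all
  its derivatives are dominated by a geometric series.\<close>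

lemma exists_tower_with_jet:
  assumes \<nu>: "mono \<nu>" "summable (\<lambda>l. 1 / \<nu> l)" "\<And>l. 0 < \<nu> l" and "0 \<le> A"
    and H: "\<And>j i. 1 \<le> j \<Longrightarrow> i \<le> j \<Longrightarrow>
       \<bar>c j\<bar> * (tail_sum \<nu> j / real j) ^ (j - i) \<le> A * (1 / 72) ^ j * partial_prod \<nu> i"
  obtains F :: "nat \<Rightarrow> real \<Rightarrow> real" and B where "derivative_tower F" "\<And>k. F k 0 = c k"
    "\<And>k t. \<bar>F k t\<bar> \<le> B * (2 ^ k * partial_prod \<nu> k)"
proof -
  let ?N = "\<lambda>k. 2 ^ k * partial_prod \<nu> k"
  have "\<exists>G :: nat \<Rightarrow> nat \<Rightarrow> real \<Rightarrow> real. \<forall>j. derivative_tower (G j) \<and>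
     (\<forall>k. G j k 0 = (if k = Suc j then c (Suc j) else 0)) \<and>
     (\<forall>k t. \<bar>G j k t\<bar> \<le> A * (1 / 72) ^ Suc j * 36 ^ Suc j * ?N k)"
    using \<open>0 \<le> A\<close> by (intro choice allI exists_adapted_monomial[OF \<nu>] H) auto
  then obtain G :: "nat \<Rightarrow> nat \<Rightarrow> real \<Rightarrow> real" where G: "\<And>j. derivative_tower (G j)"
    and G_0: "\<And>j k. G j k 0 = (if k = Suc j then c (Suc j) else 0)"
    and G_bound: "\<And>j k t. \<bar>G j k t\<bar> \<le> A * (1 / 72) ^ Suc j * 36 ^ Suc j * ?N k"
    by blast
  have half: "(1 / 72) ^ n * 36 ^ n = (1 / 2 :: real) ^ n" for n by (simp flip: power_mult_distrib)
  have G_bound': "\<bar>G j k t\<bar> \<le> (1 / 2) ^ Suc j * (A * ?N k)" for j k t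
    using G_bound[of j k t] half[of "Suc j"] by (simp only: mult_ac)
  have geo: "(\<lambda>j. (1 / 2) ^ Suc j * (A * ?N k)) sums (A * ?N k)" for k
    using sums_mult2[OF power_half_series, of "A * ?N k"] by simp
  have G_summable: "summable (\<lambda>j. G j k t)" for k t
    by (rule summable_comparison_test'[OF sums_summable[OF geo], of 0]) (use G_bound' in simp)
  have G_conv: "uniformly_convergent_on UNIV (\<lambda>n t. \<Sum>j<n. G j k t)" for k
    by (rule Weierstrass_m_test'[OF _ sums_summable[OF geo]]) (use G_bound' in simp)
  define F where "F k t = (if k = 0 then c 0 else 0) + (\<Sum>j. G j k t)" for k t
  have "derivative_tower F"
    unfolding derivative_tower_real_iff
  proof (intro allI)
    fix k t
    have "((\<lambda>t. \<Sum>j. G j k t) has_real_derivative (\<Sum>j. G j (Suc k) t)) (at t)"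
    proof (rule has_field_derivative_series'(2)[where S = UNIV])
      show "(G j k has_real_derivative G j (Suc k) x) (at x within UNIV)" for j x
        using G[of j] by (simp add: derivative_tower_real_iff)
    qed (use G_conv G_summable in auto)
    from DERIV_add[OF DERIV_const[of "if k = 0 then c 0 else 0"] this]
    show "(F k has_real_derivative F (Suc k) t) (at t)" by (simp add: F_def[abs_def])
  qed
  moreover have "F k 0 = c k" for k
  proof (cases k)
    case 0 then show ?thesis by (simp add: F_def G_0)
  next
    case (Suc k')
    have "(\<lambda>j. if j = k' then c (Suc j) else 0) sums c (Suc k')" by (rule sums_single)
    then have "(\<lambda>j. G j k 0) sums c k" using Suc by (simp add: G_0 eq_commute cong: if_cong)
    then show ?thesis using Suc by (simp add: F_def sums_iff)
  qed
  moreover have "\<bar>F k t\<bar> \<le> (\<bar>c 0\<bar> + A) * ?N k" for k t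
  proof -
    have N: "0 < ?N k" using partial_prod_pos[of \<nu> k] \<nu>(3) by simp
    have "\<bar>\<Sum>j. G j k t\<bar> \<le> (\<Sum>j. (1 / 2) ^ Suc j * (A * ?N k))"
    proof -
      have "norm (\<Sum>j. G j k t) \<le> (\<Sum>j. (1 / 2) ^ Suc j * (A * ?N k))"
      proof (rule order_trans[OF summable_norm suminf_le])
        show "norm (G j k t) \<le> (1 / 2) ^ Suc j * (A * ?N k)" for j using G_bound' by simp
        show "summable (\<lambda>j. norm (G j k t))"
          by (rule summable_comparison_test'[OF sums_summable[OF geo], of 0]) (use G_bound' in simp)
        then show "summable (\<lambda>j. norm (G j k t))" .
      qed (rule sums_summable[OF geo])
      then show ?thesis by simp
    qed
    also have "\<dots> = A * ?N k" using geo by (rule sums_unique[symmetric])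
    finally have "\<bar>\<Sum>j. G j k t\<bar> \<le> A * ?N k" .
    moreover have "\<bar>if k = 0 then c 0 else 0\<bar> \<le> \<bar>c 0\<bar> * ?N k" using N by auto
    ultimately show ?thesis unfolding F_def distrib_right by linarith
  qed
  ultimately show thesis by (rule that)
qed

section \<open>A diagonal sequence below a family of sequences\<close>

lemma sum_lessThan_add:
  "(\<Sum>l<q + p. f l) = (\<Sum>l<q. f l) + (\<Sum>l<p. f (q + l))" for f :: "nat \<Rightarrow> real"
  by (induction p) (auto simp: algebra_simps)

text \<open>Beyond some index the tail of \<open>w\<close> is small, and the finitely many terms before it are at most
  \<open>1 / c\<close> each.\<close>

lemma truncated_sum_small:
  fixes w :: "nat \<Rightarrow> real"
  assumes "summable w" "\<And>l. 0 \<le> w l" "0 < \<delta>"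
  shows "\<exists>c0. \<forall>c\<ge>c0. \<forall>L. (\<Sum>l<L. min (w l) (1 / c)) \<le> \<delta>"
proof -
  obtain K where K: "\<And>n. n \<ge> K \<Longrightarrow> norm (\<Sum>i. w (i + n)) < \<delta> / 2"
    using suminf_exist_split[OF half_gt_zero[OF \<open>0 < \<delta>\<close>] \<open>summable w\<close>] by blast
  define c0 where "c0 = 2 * (real K + 1) / \<delta>"
  have "(\<Sum>l<L. min (w l) (1 / c)) \<le> \<delta>" if "c \<ge> c0" for c L
  proof -
    have "0 < c0" using \<open>0 < \<delta>\<close> by (simp add: c0_def)
    then have "0 < c" using that by linarith
    have "(\<Sum>l<L. min (w l) (1 / c)) \<le> (\<Sum>l<K + L. min (w l) (1 / c))"
      using assms(2) \<open>0 < c\<close> by (intro sum_mono2) auto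
    also have "\<dots> = (\<Sum>l<K. min (w l) (1 / c)) + (\<Sum>l<L. min (w (K + l)) (1 / c))"
      by (rule sum_lessThan_add)
    also have "\<dots> \<le> (\<Sum>l<K. 1 / c) + (\<Sum>l<L. w (l + K))"
      by (intro add_mono sum_mono) (auto simp: add.commute)
    also have "(\<Sum>l<L. w (l + K)) \<le> (\<Sum>l. w (l + K))"
      using assms by (intro sum_le_suminf) (auto simp: summable_iff_shift)
    also have "\<dots> \<le> \<delta> / 2" using K[of K] by simp
    also have "(\<Sum>l<K. 1 / c) \<le> \<delta> / 2"
    proof -
      have "c * \<delta> \<ge> 2 * (real K + 1)" using that \<open>0 < \<delta>\<close> by (simp add: c0_def field_simps)
      then have "c * \<delta> \<ge> 2 * real K" by simp
      then show ?thesis using \<open>0 < c\<close> by (simp add: field_simps)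
    qed
    finally show ?thesis by simp
  qed
  then show ?thesis by blast
qed

lemma inverse_summable_unbounded:
  fixes \<nu> :: "nat \<Rightarrow> real"
  assumes "summable (\<lambda>l. 1 / \<nu> l)" "\<And>l. 0 < \<nu> l"
  shows "\<exists>L. \<forall>l\<ge>L. X < \<nu> l"
proof -
  have "eventually (\<lambda>l. 1 / \<nu> l < 1 / (\<bar>X\<bar> + 1)) sequentially"
    using summable_LIMSEQ_zero[OF assms(1)] by (rule order_tendstoD) auto
  moreover have "X < \<nu> l" if "1 / \<nu> l < 1 / (\<bar>X\<bar> + 1)" for l
    using that assms(2)[of l] by (simp add: field_simps)
  ultimately show ?thesis unfolding eventually_sequentially by blast
qed

text \<open>The thresholds \<open>T m\<close> that govern the passage from one member of the family \<open>\<kappa>\<close> to the next. The last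
  condition makes the contribution of \<open>\<kappa> (m + 1)\<close> to the tails negligible against \<open>1 / T m\<close>.\<close>

lemma exists_thresholds:
  fixes \<kappa> :: "nat \<Rightarrow> nat \<Rightarrow> real" and J :: "nat \<Rightarrow> nat"
  assumes "\<And>n. summable (\<lambda>l. 1 / \<kappa> n l)" "\<And>n l. 0 < \<kappa> n l"
  shows "\<exists>T :: nat \<Rightarrow> real. (\<forall>m. 0 < T m) \<and> mono T \<and> (\<forall>m. real m \<le> T m) \<and> (\<forall>m. \<kappa> 0 (J (Suc m)) \<le> T m) \<and>
    (\<forall>m L. (\<Sum>l<L. min (1 / \<kappa> (Suc m) l) (1 / T (Suc m))) \<le> (1 / 2) ^ Suc m / T m)"
proof -
  define P where "P m t \<longleftrightarrow> 0 < t \<and> real m \<le> t \<and> \<kappa> 0 (J (Suc m)) \<le> t" for m t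
  define Q where "Q m t t' \<longleftrightarrow> t \<le> t' \<and>
    (\<forall>L. (\<Sum>l<L. min (1 / \<kappa> (Suc m) l) (1 / t')) \<le> (1 / 2) ^ Suc m / t)" for m and t t' :: real
  have "\<exists>T. \<forall>m. P m (T m) \<and> Q m (T m) (T (Suc m))"
  proof (rule dependent_nat_choice)
    show "\<exists>t. P 0 t" using assms(2) unfolding P_def by (intro exI[of _ "\<kappa> 0 (J (Suc 0))"]) (simp add: less_imp_le)
    show "\<exists>t'. P (Suc m) t' \<and> Q m t t'" if "P m t" for t m
    proof -
      have "0 < (1 / 2) ^ Suc m / t" using that by (simp add: P_def)
      then obtain c0 where c0: "\<And>c L. c \<ge> c0 \<Longrightarrow>
          (\<Sum>l<L. min (1 / \<kappa> (Suc m) l) (1 / c)) \<le> (1 / 2) ^ Suc m / t"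
        using truncated_sum_small[OF assms(1)] assms(2) by (metis less_imp_le zero_less_divide_1_iff)
      define t' where "t' = max (max c0 t) (max (real (Suc m)) (\<kappa> 0 (J (Suc (Suc m)))))"
      have "t' \<ge> c0" "t' \<ge> t" "real (Suc m) \<le> t'" "\<kappa> 0 (J (Suc (Suc m))) \<le> t'"
        by (auto simp: t'_def)
      moreover have "0 < t'" using \<open>t' \<ge> t\<close> that by (simp add: P_def)
      ultimately show ?thesis using c0 unfolding P_def Q_def by blast
    qed
  qed
  then obtain T where T: "\<And>m. P m (T m)" "\<And>m. Q m (T m) (T (Suc m))" by blast
  moreover have "mono T" using T(2) by (intro incseq_SucI) (auto simp: Q_def)
  ultimately show ?thesis unfolding P_def Q_def by blast
qed

text \<open>The sequence \<open>\<sigma> l\<close> is the infimum over \<open>n\<close> of \<open>max (\<kappa> n l) (T n)\<close>; it is attained since \<open>T\<close> tends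
  to infinity. For fixed \<open>n\<close> it is at most \<open>\<kappa> n l\<close> once \<open>\<kappa> n l\<close> has passed \<open>T n\<close>. If \<open>T\<close> is increasing,
  then a value below \<open>T n\<close> can only be attained at an index below \<open>n\<close>.\<close>

lemma exists_envelope:
  fixes \<kappa> :: "nat \<Rightarrow> nat \<Rightarrow> real"
  assumes "\<And>m. real m \<le> T m"
  shows "\<exists>\<sigma>. \<forall>l. (\<exists>m. \<sigma> l = max (\<kappa> m l) (T m)) \<and> (\<forall>n. \<sigma> l \<le> max (\<kappa> n l) (T n))"
proof (rule choice, rule allI)
  fix l
  let ?h = "\<lambda>n. max (\<kappa> n l) (T n)"
  obtain n0 :: nat where n0: "?h 0 \<le> real n0" using real_arch_simple by blast
  have "Min (?h ` {..n0}) \<in> ?h ` {..n0}" by (intro Min_in) auto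
  moreover have "Min (?h ` {..n0}) \<le> ?h n" for n
  proof (cases "n \<le> n0")
    case False
    have "Min (?h ` {..n0}) \<le> ?h 0" by (intro Min_le) auto
    also have "\<dots> \<le> real n" using n0 False by simp
    also have "\<dots> \<le> ?h n" using assms[of n] by simp
    finally show ?thesis .
  qed (auto intro: Min_le)
  ultimately show "\<exists>s. (\<exists>m. s = ?h m) \<and> (\<forall>n. s \<le> ?h n)" by blast
qed

lemma sum_half_powers_le: "(\<Sum>m\<in>{q<..n}. (1 / 2) ^ m) \<le> (1 :: real)"
proof -
  have "(\<Sum>m\<in>{q<..n}. (1 / 2) ^ m) \<le> (\<Sum>m\<in>{1..n}. (1 / 2 :: real) ^ m)"
    by (intro sum_mono2) auto
  also have "\<dots> = (\<Sum>m<n. (1 / 2) ^ Suc m)" 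
    by (rule sum.reindex_bij_witness[of _ Suc "\<lambda>m. m - 1"]) auto
  also have "\<dots> \<le> (\<Sum>m. (1 / 2) ^ Suc m)"
    using power_half_series by (intro sum_le_suminf) (auto simp: sums_iff)
  also have "\<dots> = 1" using power_half_series by (simp add: sums_iff)
  finally show ?thesis .
qed

text \<open>A term of the envelope that is realized by an index up to \<open>q\<close> is at most the corresponding term for
  \<open>\<kappa> q\<close>. The terms realized by one and the same later index \<open>m\<close> add up to at most \<open>2\<^sup>-\<^sup>m / T q\<close>.\<close>

lemma envelope_sum_le:
  fixes \<kappa> :: "nat \<Rightarrow> nat \<Rightarrow> real"
  assumes pos: "\<And>n l. 0 < \<kappa> n l" and anti: "\<And>m n l. m \<le> n \<Longrightarrow> \<kappa> n l \<le> \<kappa> m l"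
    and T: "\<And>m. 0 < T m" "mono T"
    and small: "\<And>m L. (\<Sum>l<L. min (1 / \<kappa> (Suc m) l) (1 / T (Suc m))) \<le> (1 / 2) ^ Suc m / T m"
    and \<sigma>: "\<And>l. \<exists>m. \<sigma> l = max (\<kappa> m l) (T m)"
  shows "(\<Sum>l<L. 1 / \<sigma> (j + l)) \<le> (\<Sum>l<L. 1 / \<kappa> q (j + l)) + 1 / T q"
proof -
  obtain \<mu> where \<mu>: "\<And>l. \<sigma> l = max (\<kappa> (\<mu> l) l) (T (\<mu> l))" using \<sigma> by metis
  define n where "n = Max (insert 0 (\<mu> ` {j..<j + L}))"
  have \<mu>_le: "\<mu> (j + l) \<le> n" if "l < L" for l unfolding n_def using that by (intro Max_ge) auto
  let ?g = "\<lambda>m l. min (1 / \<kappa> m l) (1 / T m)"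
  have g_nonneg: "0 \<le> ?g m l" for m l using pos[of m l] T(1)[of m] by simp
  have "1 / \<sigma> (j + l) \<le> 1 / \<kappa> q (j + l) + (\<Sum>m\<in>{q<..n}. ?g m (j + l))" if "l < L" for l
  proof (cases "\<mu> (j + l) \<le> q")
    case True
    have "\<kappa> q (j + l) \<le> \<sigma> (j + l)" using anti[OF True, of "j + l"] \<mu>[of "j + l"] by simp
    then have "1 / \<sigma> (j + l) \<le> 1 / \<kappa> q (j + l)"
      using pos[of q "j + l"] by (intro divide_left_mono mult_pos_pos) auto
    moreover have "0 \<le> (\<Sum>m\<in>{q<..n}. ?g m (j + l))" by (intro sum_nonneg g_nonneg)
    ultimately show ?thesis by linarith
  next
    case False
    have "1 / \<sigma> (j + l) = ?g (\<mu> (j + l)) (j + l)"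
      using pos[of "\<mu> (j + l)" "j + l"] T(1)[of "\<mu> (j + l)"] unfolding \<mu>[of "j + l"]
      by (auto simp: max_def min_def field_simps)
    also have "\<dots> \<le> (\<Sum>m\<in>{q<..n}. ?g m (j + l))"
      using False \<mu>_le[OF that] by (intro member_le_sum[of "\<mu> (j + l)" _ "\<lambda>m. ?g m (j + l)"] g_nonneg) auto
    finally show ?thesis using pos[of q "j + l"] by (smt (verit) zero_less_divide_1_iff)
  qed
  then have "(\<Sum>l<L. 1 / \<sigma> (j + l)) \<le> (\<Sum>l<L. 1 / \<kappa> q (j + l) + (\<Sum>m\<in>{q<..n}. ?g m (j + l)))"
    by (intro sum_mono) auto
  also have "\<dots> = (\<Sum>l<L. 1 / \<kappa> q (j + l)) + (\<Sum>m\<in>{q<..n}. \<Sum>l<L. ?g m (j + l))"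
    unfolding sum.distrib by (subst sum.swap) simp
  also have "(\<Sum>m\<in>{q<..n}. \<Sum>l<L. ?g m (j + l)) \<le> (\<Sum>m\<in>{q<..n}. (1 / 2) ^ m * (1 / T q))"
  proof (rule sum_mono)
    fix m assume "m \<in> {q<..n}"
    then obtain m' where m': "m = Suc m'" "q \<le> m'" by (cases m) auto
    have "(\<Sum>l<L. ?g m (j + l)) \<le> (\<Sum>l<j. ?g m l) + (\<Sum>l<L. ?g m (j + l))"
      using g_nonneg by (simp add: sum_nonneg)
    also have "\<dots> = (\<Sum>l<j + L. ?g m l)" by (rule sum_lessThan_add[symmetric])
    also have "\<dots> \<le> (1 / 2) ^ m / T m'" unfolding m'(1) by (rule small)
    also have "\<dots> \<le> (1 / 2) ^ m / T q"
      using T(1) monoD[OF T(2) m'(2)] by (intro divide_left_mono) auto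
    finally show "(\<Sum>l<L. ?g m (j + l)) \<le> (1 / 2) ^ m * (1 / T q)" by simp
  qed
  also have "\<dots> \<le> 1 * (1 / T q)"
    unfolding sum_distrib_right[symmetric] using T(1)[of q] by (intro mult_right_mono sum_half_powers_le) auto
  finally show ?thesis by simp
qed

text \<open>For given \<open>j\<close> let \<open>q\<close> be the least index with \<open>\<kappa> 0 j \<le> T q\<close>. Then up to \<open>j\<close> the envelope \<open>\<sigma>\<close> lies above
  \<open>\<kappa> q\<close>, and its tail from \<open>j\<close> on exceeds that of \<open>\<kappa> q\<close> by at most \<open>1 / T q \<le> 1 / \<kappa> q j\<close>, that is,
  it is at most twice as large. Minimality of \<open>q\<close> and the choice of the thresholds force
  \<open>j \<ge> J q\<close> unless \<open>q = 0\<close>, so that the hypothesis for \<open>\<kappa> q\<close> carries over to \<open>\<sigma>\<close>. The case \<open>q = 0\<close>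
  concerns finitely many \<open>j\<close> and is absorbed by \<open>A\<close>.\<close>

lemma exists_diagonal_sequence:
  fixes \<kappa> :: "nat \<Rightarrow> nat \<Rightarrow> real" and c :: "nat \<Rightarrow> real"
  assumes mono: "\<And>n. mono (\<kappa> n)" and pos: "\<And>n l. 0 < \<kappa> n l"
    and summable: "\<And>n. summable (\<lambda>l. 1 / \<kappa> n l)"
    and anti: "\<And>m n l. m \<le> n \<Longrightarrow> \<kappa> n l \<le> \<kappa> m l"
    and H: "\<And>n. \<exists>J. \<forall>j\<ge>J. \<forall>i<j.
       \<bar>c j\<bar> * (2 * tail_sum (\<kappa> n) j / real j) ^ (j - i) \<le> (1 / 144) ^ j * partial_prod (\<kappa> n) i"
  obtains \<sigma> A where "mono \<sigma>" "\<And>l. 0 < \<sigma> l" "summable (\<lambda>l. 1 / \<sigma> l)"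
    "\<And>n. \<exists>L. \<forall>l\<ge>L. \<sigma> l \<le> \<kappa> n l" "0 \<le> A"
    "\<And>j i. 1 \<le> j \<Longrightarrow> i \<le> j \<Longrightarrow>
       \<bar>c j\<bar> * (tail_sum \<sigma> j / real j) ^ (j - i) \<le> A * (1 / 72) ^ j * partial_prod \<sigma> i"
proof -
  obtain J where J: "\<And>n j i. j \<ge> J n \<Longrightarrow> i < j \<Longrightarrow>
       \<bar>c j\<bar> * (2 * tail_sum (\<kappa> n) j / real j) ^ (j - i) \<le> (1 / 144) ^ j * partial_prod (\<kappa> n) i"
    using H by metis
  obtain T where T_pos: "\<And>m. 0 < T m" and T_mono: "mono T" and T_ge: "\<And>m. real m \<le> T m"
    and T_J: "\<And>m. \<kappa> 0 (J (Suc m)) \<le> T m"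
    and T_small: "\<And>m L. (\<Sum>l<L. min (1 / \<kappa> (Suc m) l) (1 / T (Suc m))) \<le> (1 / 2) ^ Suc m / T m"
    using exists_thresholds[where \<kappa> = \<kappa> and J = J, OF summable pos] by blast
  obtain \<sigma> where \<sigma>_ex: "\<And>l. \<exists>m. \<sigma> l = max (\<kappa> m l) (T m)" and \<sigma>_le: "\<And>l n. \<sigma> l \<le> max (\<kappa> n l) (T n)"
    using exists_envelope[OF T_ge, of \<kappa>] by blast
  have \<sigma>_pos: "0 < \<sigma> l" for l using \<sigma>_ex[of l] pos T_pos by (auto simp: less_max_iff_disj)
  have \<sigma>_mono: "mono \<sigma>"
  proof (rule monoI)
    fix l l' :: nat assume "l \<le> l'"
    obtain m where m: "\<sigma> l' = max (\<kappa> m l') (T m)" using \<sigma>_ex by blast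
    have "\<kappa> m l \<le> \<kappa> m l'" by (rule monoD[OF mono \<open>l \<le> l'\<close>])
    then show "\<sigma> l \<le> \<sigma> l'" using \<sigma>_le[of l m] unfolding m by linarith
  qed
  have \<sigma>_sum: "(\<Sum>l<L. 1 / \<sigma> (j + l)) \<le> (\<Sum>l<L. 1 / \<kappa> q (j + l)) + 1 / T q" for L j q
    by (rule envelope_sum_le[OF pos anti T_pos T_mono T_small \<sigma>_ex])
  have partial_le: "(\<Sum>l<L. 1 / \<kappa> q (j + l)) \<le> tail_sum (\<kappa> q) j" for L q j
    unfolding tail_sum_def using summable_tail[OF summable, of q j] pos
    by (intro sum_le_suminf) (auto simp: less_imp_le)
  have \<sigma>_summable: "summable (\<lambda>l. 1 / \<sigma> l)"
  proof (rule summableI_nonneg_bounded)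
    show "(\<Sum>l<L. 1 / \<sigma> l) \<le> tail_sum (\<kappa> 0) 0 + 1 / T 0" for L
      using \<sigma>_sum[where L = L and j = 0 and q = 0] partial_le[where L = L and q = 0 and j = 0] by simp
  qed (use \<sigma>_pos in \<open>simp add: less_imp_le\<close>)
  have \<sigma>_below: "\<exists>L. \<forall>l\<ge>L. \<sigma> l \<le> \<kappa> n l" for n
  proof -
    obtain L where "\<And>l. l \<ge> L \<Longrightarrow> T n < \<kappa> n l" using inverse_summable_unbounded[OF summable pos] by blast
    then have "\<sigma> l \<le> \<kappa> n l" if "l \<ge> L" for l using \<sigma>_le[of l n] that by (metis less_imp_le max.absorb1)
    then show ?thesis by blast
  qed
  have tail_pos: "0 < tail_sum \<sigma> j" for j by (rule tail_sum_pos[OF \<sigma>_summable \<sigma>_pos])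
  obtain L0 where L0: "\<And>j. j \<ge> L0 \<Longrightarrow> T 0 < \<kappa> 0 j" using inverse_summable_unbounded[OF summable pos] by blast
  have large: "\<bar>c j\<bar> * (tail_sum \<sigma> j / real j) ^ (j - i) \<le> (1 / 72) ^ j * partial_prod \<sigma> i"
    if "j \<ge> L0" "j \<ge> 1" "i \<le> j" for i j
  proof -
    define q where "q = (LEAST q. \<kappa> 0 j \<le> T q)"
    have "\<exists>q. \<kappa> 0 j \<le> T q" using T_ge real_arch_simple order_trans by meson
    then have q: "\<kappa> 0 j \<le> T q" unfolding q_def by (rule LeastI_ex)
    have "q \<noteq> 0" using q L0[OF that(1)] by (metis not_le)
    then obtain q' where q': "q = Suc q'" by (cases q) auto
    have "\<not> \<kappa> 0 j \<le> T q'" using not_less_Least[of q' "\<lambda>q. \<kappa> 0 j \<le> T q"] q' unfolding q_def[symmetric] by simp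
    then have "\<kappa> 0 (J q) < \<kappa> 0 j" using T_J[of q'] q' by simp
    then have "J q \<le> j" using monoD[OF mono, of j "J q" 0] by linarith
    have tail_le: "tail_sum \<sigma> j \<le> 2 * tail_sum (\<kappa> q) j"
    proof -
      have "tail_sum \<sigma> j \<le> tail_sum (\<kappa> q) j + 1 / T q"
        unfolding tail_sum_def[of \<sigma>]
        using \<sigma>_sum[where j = j and q = q] partial_le[where j = j and q = q] 
        by (intro suminf_le_const[OF summable_tail[OF \<sigma>_summable]]) (meson add_right_mono order_trans)
      moreover have "1 / T q \<le> 1 / \<kappa> q j"
        using q anti[of 0 q j] T_pos[of q] pos[of q j] by (intro divide_left_mono mult_pos_pos) auto
      moreover have "1 / \<kappa> q j \<le> tail_sum (\<kappa> q) j" using partial_le[where L = 1 and q = q and j = j] by simp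
      ultimately show ?thesis by linarith
    qed
    have prod_le: "partial_prod (\<kappa> q) i \<le> partial_prod \<sigma> i" if "i \<le> j" for i
    proof (rule partial_prod_mono[OF _ pos])
      fix l assume "l \<le> i"
      obtain m where m: "\<sigma> l = max (\<kappa> m l) (T m)" using \<sigma>_ex by blast
      show "\<kappa> q l \<le> \<sigma> l"
      proof (cases "m \<le> q")
        case True then show ?thesis using anti[OF True, of l] m by simp
      next
        case False
        have "\<kappa> q l \<le> \<kappa> 0 l" by (rule anti) simp
        also have "\<dots> \<le> \<kappa> 0 j" using \<open>l \<le> i\<close> that by (intro monoD[OF mono]) simp
        also have "\<dots> \<le> T q" by fact
        also have "\<dots> \<le> T m" using False by (intro monoD[OF T_mono]) simp
        finally show ?thesis using m by simp
      qed
    qed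
    have less: "\<bar>c j\<bar> * (tail_sum \<sigma> j / real j) ^ (j - i) \<le> (1 / 144) ^ j * partial_prod \<sigma> i"
      if "i < j" for i
    proof -
      have "\<bar>c j\<bar> * (tail_sum \<sigma> j / real j) ^ (j - i) \<le> \<bar>c j\<bar> * (2 * tail_sum (\<kappa> q) j / real j) ^ (j - i)"
        using tail_le tail_pos[of j] by (intro mult_left_mono power_mono divide_right_mono) auto
      also have "\<dots> \<le> (1 / 144) ^ j * partial_prod (\<kappa> q) i" by (rule J[OF \<open>J q \<le> j\<close> that])
      also have "\<dots> \<le> (1 / 144) ^ j * partial_prod \<sigma> i" using prod_le that by (intro mult_left_mono) auto
      finally show ?thesis .
    qed
    have prod_pos: "0 < partial_prod \<sigma> i" for i by (rule partial_prod_pos[OF \<sigma>_pos])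
    show ?thesis
    proof (cases "i = j")
      case False
      have "(1 / 144) ^ j * partial_prod \<sigma> i \<le> (1 / 72) ^ j * partial_prod \<sigma> i"
        using prod_pos[of i] by (intro mult_right_mono power_mono) auto
      then show ?thesis using less[of i] that False by linarith
    next
      case True
      \<comment> \<open>The case \<open>i = j\<close> follows from \<open>i = j - 1\<close> because the tail is at least \<open>1 / \<sigma> j\<close>; the factor \<open>j \<le> 2\<^sup>j\<close>
        accounts for the change from \<open>144\<close> to \<open>72\<close>.\<close>
      obtain j' where j': "j = Suc j'" using \<open>j \<ge> 1\<close> by (cases j) auto
      have "1 / \<sigma> j \<le> tail_sum \<sigma> j"
        using tail_sum_Suc[OF \<sigma>_summable, of j] tail_pos[of "Suc j"] by linarith
      then have "\<bar>c j\<bar> * (1 / \<sigma> j / real j) \<le> \<bar>c j\<bar> * (tail_sum \<sigma> j / real j)"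
        by (intro mult_left_mono divide_right_mono) auto
      also have "\<dots> \<le> (1 / 144) ^ j * partial_prod \<sigma> j'" using less[of j'] j' by simp
      finally have "\<bar>c j\<bar> \<le> (1 / 144) ^ j * partial_prod \<sigma> j' * (real j * \<sigma> j)"
        using \<sigma>_pos[of j] \<open>j \<ge> 1\<close> by (simp add: field_simps)
      also have "\<dots> = (1 / 144) ^ j * real j * partial_prod \<sigma> j" by (simp add: j')
      also have "\<dots> \<le> (1 / 144) ^ j * 2 ^ j * partial_prod \<sigma> j"
        using prod_pos[of j] of_nat_less_two_power[of j, where 'a = real]
        by (intro mult_right_mono mult_left_mono) (auto simp: less_imp_le)
      also have "(1 / 144) ^ j * 2 ^ j = (1 / 72 :: real) ^ j" by (simp flip: power_mult_distrib)
      finally show ?thesis using True by simp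
    qed
  qed
  define R where "R j i = \<bar>c j\<bar> * (tail_sum \<sigma> j / real j) ^ (j - i) / ((1 / 72) ^ j * partial_prod \<sigma> i)" for j i
  have prod_pos: "0 < (1 / 72) ^ j * partial_prod \<sigma> i" for i j using partial_prod_pos[OF \<sigma>_pos] by simp
  have R_nonneg: "0 \<le> R j i" for j i
    unfolding R_def using tail_pos[of j] prod_pos[of j i] by (intro divide_nonneg_pos) auto
  define A where "A = 1 + (\<Sum>j<L0. \<Sum>i\<le>j. R j i)"
  have "0 \<le> (\<Sum>j<L0. \<Sum>i\<le>j. R j i)" using R_nonneg by (intro sum_nonneg) auto
  then have "A \<ge> 1" by (simp add: A_def)
  have "R j i \<le> A" if "j \<ge> 1" "i \<le> j" for i j
  proof (cases "j < L0")
    case True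
    have "R j i \<le> (\<Sum>i\<le>j. R j i)" using that R_nonneg by (intro member_le_sum) auto
    also have "\<dots> \<le> (\<Sum>j<L0. \<Sum>i\<le>j. R j i)"
      using True R_nonneg by (intro member_le_sum[of j _ "\<lambda>j. \<Sum>i\<le>j. R j i"] sum_nonneg) auto
    finally show ?thesis by (simp add: A_def)
  next
    case False
    then have "R j i \<le> 1" using large[of j i] that prod_pos[of j i] by (simp add: R_def divide_le_eq)
    then show ?thesis using \<open>A \<ge> 1\<close> by linarith
  qed
  then have "\<bar>c j\<bar> * (tail_sum \<sigma> j / real j) ^ (j - i) \<le> A * (1 / 72) ^ j * partial_prod \<sigma> i"
    if "j \<ge> 1" "i \<le> j" for i j
    using that prod_pos[of j i] unfolding R_def pos_divide_le_eq[OF prod_pos] by (simp add: mult_ac)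
  then show thesis
    using \<open>A \<ge> 1\<close> by (intro that[of \<sigma> A] \<sigma>_mono \<sigma>_pos \<sigma>_summable \<sigma>_below) auto
qed

section \<open>Sufficiency for weight matrices\<close>

lemma Beurling_sequence_eventually_small:
  assumes a: "a \<in> Beurling_sequences \<MM>" and "x > 0" "\<theta> > 0" and pos: "\<And>k. 0 < \<MM> x k"
  shows "\<exists>J. \<forall>j\<ge>J. norm (a j) \<le> \<theta> ^ j * \<MM> x j"
proof -
  have "bdd_above (range (\<lambda>k. norm (a k) / ((\<theta> / 2) ^ k * \<MM> x k)))"
    using a \<open>x > 0\<close> \<open>\<theta> > 0\<close> unfolding Beurling_sequences_def by simp
  then obtain K where K: "\<And>k. norm (a k) / ((\<theta> / 2) ^ k * \<MM> x k) \<le> K"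
    unfolding bdd_above_def by auto
  obtain J :: nat where J: "K < 2 ^ J" using real_arch_pow[of 2 K] by auto
  have "norm (a j) \<le> \<theta> ^ j * \<MM> x j" if "j \<ge> J" for j
  proof -
    have w: "0 < (\<theta> / 2) ^ j * \<MM> x j" using \<open>\<theta> > 0\<close> pos[of j] by simp
    have "norm (a j) \<le> K * ((\<theta> / 2) ^ j * \<MM> x j)" using K[of j] w by (simp only: pos_divide_le_eq)
    also have "\<dots> \<le> 2 ^ j * ((\<theta> / 2) ^ j * \<MM> x j)"
    proof (rule mult_right_mono)
      have "(2 :: real) ^ J \<le> 2 ^ j" using that by (intro power_increasing) auto
      then show "K \<le> 2 ^ j" using J by linarith
    qed (use w in simp)
    also have "\<dots> = \<theta> ^ j * \<MM> x j" by (simp add: power_divide)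
    finally show ?thesis .
  qed
  then show ?thesis by blast
qed

text \<open>The diagonal construction is applied to \<open>\<kappa> n = \<nu>\<^bsup>(1/(n+1))\<^esup> / (n+1)\<close>; dividing by \<open>n + 1\<close> produces
  the arbitrary geometric factors \<open>r\<^sup>k\<close>. The order of the quotients makes \<open>\<kappa>\<close> decreasing in \<open>n\<close>.\<close>

lemma exists_real_Beurling_tower:
  fixes c :: "nat \<Rightarrow> real"
  assumes M: "weight_matrix \<MM>" and N: "weight_matrix \<NN>" and ord: "quotient_ordered \<NN>"
    and prec: "\<forall>y>0. \<exists>x>0. \<MM> x \<prec>\<^sub>S\<^sub>V \<NN> y"
    and a: "a \<in> Beurling_sequences \<MM>" and c: "\<And>j. \<bar>c j\<bar> \<le> norm (a j)"
  obtains F :: "nat \<Rightarrow> real \<Rightarrow> real" where "derivative_tower F" "\<And>k. F k 0 = c k"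
    "\<And>r y. r > 0 \<Longrightarrow> y > 0 \<Longrightarrow> \<exists>B. \<forall>k t. \<bar>F k t\<bar> \<le> B * (r ^ k * \<NN> y k)"
proof -
  define y where "y n = 1 / real (Suc n)" for n
  have y_pos: "y n > 0" for n by (simp add: y_def)
  have N_weight: "weight_sequence (\<NN> (y n))" for n using N y_pos by (simp add: weight_matrix_def)
  note \<nu> = weight_sequence_quotients[OF N_weight]
  define \<kappa> where "\<kappa> n l = quotients (\<NN> (y n)) l / real (Suc n)" for n l
  have summable: "summable (\<lambda>l. 1 / quotients (\<NN> (y n)) l)" for n
  proof -
    obtain x where "x > 0" "\<MM> x \<prec>\<^sub>S\<^sub>V \<NN> (y n)" using prec y_pos by blast
    then show ?thesis using M N_weight by (intro prec_SV_imp_summable) (auto simp: weight_matrix_def)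
  qed
  have \<kappa>_pos: "0 < \<kappa> n l" for n l using \<nu>(2) by (simp add: \<kappa>_def)
  have \<kappa>_anti: "\<kappa> n l \<le> \<kappa> m l" if "m \<le> n" for m n l
  proof -
    have "y n \<le> y m" using that by (simp add: y_def frac_le)
    then have "quotients (\<NN> (y n)) l \<le> quotients (\<NN> (y m)) l"
      using ord y_pos unfolding quotient_ordered_def quotients_def by auto
    then show ?thesis unfolding \<kappa>_def using that \<nu>(2) by (intro frac_le) (auto simp: less_imp_le)
  qed
  have small: "\<exists>J. \<forall>j\<ge>J. \<forall>i<j.
       \<bar>c j\<bar> * (2 * tail_sum (\<kappa> n) j / real j) ^ (j - i) \<le> (1 / 144) ^ j * partial_prod (\<kappa> n) i" for n
  proof -
    obtain x where "x > 0" and xy: "\<MM> x \<prec>\<^sub>S\<^sub>V \<NN> (y n)" using prec y_pos by blast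
    have M_weight: "weight_sequence (\<MM> x)" using M \<open>x > 0\<close> by (simp add: weight_matrix_def)
    let ?S = "tail_sum (quotients (\<NN> (y n)))"
    obtain C s :: nat where Cs: "C \<ge> 1" "s \<ge> 1" and
      le: "\<And>j i. j \<ge> 1 \<Longrightarrow> i < j \<Longrightarrow>
         \<MM> x j * (?S j / real j) ^ (j - i) \<le> real C ^ (j - i) * real s ^ j * \<NN> (y n) i"
      using xy unfolding prec_SV_iff[OF M_weight N_weight summable] by blast
    define b where "b = real (Suc n)"
    have b: "b \<ge> 1" by (simp add: b_def)
    \<comment> \<open>\<open>\<theta>\<close> absorbs all constants with exponent at most \<open>j\<close>: the factor \<open>2 b\<close> from the scaled tails and
      products, and \<open>C\<close> and \<open>s\<close> from the condition.\<close>
    define \<theta> where "\<theta> = 1 / (144 * (2 * b) * real C * real s)"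
    have "\<theta> > 0" using Cs by (simp add: \<theta>_def b_def)
    obtain J where J: "\<And>j. j \<ge> J \<Longrightarrow> norm (a j) \<le> \<theta> ^ j * \<MM> x j"
      using Beurling_sequence_eventually_small[OF a \<open>x > 0\<close> \<open>\<theta> > 0\<close>]
        weight_sequence_quotients(4)[OF M_weight] by blast
    have tail: "tail_sum (\<kappa> n) j = b * ?S j" for j
      unfolding \<kappa>_def b_def by (rule tail_sum_scaled[OF summable])
    have prod: "partial_prod (\<kappa> n) i = \<NN> (y n) i / b ^ i" for i
      unfolding \<kappa>_def b_def partial_prod_scaled \<nu>(3) ..
    have "\<bar>c j\<bar> * (2 * tail_sum (\<kappa> n) j / real j) ^ (j - i) \<le> (1 / 144) ^ j * partial_prod (\<kappa> n) i"
      if "j \<ge> J" "i < j" for j i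
    proof -
      define d where "d = j - i"
      have j: "j = d + i" using that by (simp add: d_def)
      have S: "0 \<le> ?S j / real j" using tail_sum_pos[OF summable \<nu>(2), of n j] by simp
      have Npos: "0 < \<NN> (y n) i" by (rule \<nu>(4))
      have "\<bar>c j\<bar> * (2 * tail_sum (\<kappa> n) j / real j) ^ d = \<bar>c j\<bar> * ((2 * b) ^ d * (?S j / real j) ^ d)"
        by (simp add: tail power_mult_distrib power_divide)
      also have "\<dots> \<le> (\<theta> ^ j * \<MM> x j) * ((2 * b) ^ d * (?S j / real j) ^ d)"
        using c[of j] J[OF that(1)] S b by (intro mult_right_mono) auto
      also have "\<dots> = \<theta> ^ j * (2 * b) ^ d * (\<MM> x j * (?S j / real j) ^ d)" by (simp only: mult_ac)
      also have "\<dots> \<le> \<theta> ^ j * (2 * b) ^ d * (real C ^ d * real s ^ j * \<NN> (y n) i)"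
        using le[of j i] that \<open>\<theta> > 0\<close> b unfolding d_def by (intro mult_left_mono) auto
      also have "\<dots> \<le> \<theta> ^ j * ((2 * b) ^ j / b ^ i) * (real C ^ j * real s ^ j * \<NN> (y n) i)"
      proof (intro mult_mono mult_left_mono mult_right_mono)
        have "b ^ i \<le> (2 * b) ^ i" using b by (intro power_mono) auto
        then have "(2 * b) ^ d * b ^ i \<le> (2 * b) ^ d * (2 * b) ^ i" using b by (intro mult_left_mono) auto
        then show "(2 * b) ^ d \<le> (2 * b) ^ j / b ^ i"
          using b unfolding j power_add by (subst pos_le_divide_eq) auto
        show "real C ^ d \<le> real C ^ j" using Cs by (intro power_increasing) (auto simp: j)
      qed (use \<open>\<theta> > 0\<close> b Cs Npos in auto)
      also have "\<dots> = (\<theta> * (2 * b) * real C * real s) ^ j * (\<NN> (y n) i / b ^ i)"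
        by (simp add: power_mult_distrib)
      also have "\<theta> * (2 * b) * real C * real s = 1 / 144" using Cs b by (simp add: \<theta>_def)
      finally show ?thesis by (simp add: prod d_def)
    qed
    then show ?thesis by blast
  qed
  have \<kappa>_mono: "mono (\<kappa> n)" for n
    using \<nu>(1)[of n] unfolding \<kappa>_def by (auto simp: mono_def intro: divide_right_mono)
  have \<kappa>_summable: "summable (\<lambda>l. 1 / \<kappa> n l)" for n
    using summable_mult[OF summable[of n], of "real (Suc n)"] by (simp add: \<kappa>_def)
  obtain \<sigma> A where \<sigma>: "mono \<sigma>" "\<And>l. 0 < \<sigma> l" "summable (\<lambda>l. 1 / \<sigma> l)"
    and \<sigma>_le: "\<And>n. \<exists>L. \<forall>l\<ge>L. \<sigma> l \<le> \<kappa> n l" and "A \<ge> 0"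
    and A: "\<And>j i. 1 \<le> j \<Longrightarrow> i \<le> j \<Longrightarrow>
       \<bar>c j\<bar> * (tail_sum \<sigma> j / real j) ^ (j - i) \<le> A * (1 / 72) ^ j * partial_prod \<sigma> i"
    by (rule exists_diagonal_sequence[where \<kappa> = \<kappa>, OF \<kappa>_mono \<kappa>_pos \<kappa>_summable \<kappa>_anti small]) (assumption, rule that)
  obtain F :: "nat \<Rightarrow> real \<Rightarrow> real" and B where F: "derivative_tower F" "\<And>k. F k 0 = c k"
    and B: "\<And>k t. \<bar>F k t\<bar> \<le> B * (2 ^ k * partial_prod \<sigma> k)"
    by (rule exists_tower_with_jet[OF \<sigma>(1,3,2) \<open>A \<ge> 0\<close> A]) (assumption, assumption, rule that)
  have "\<exists>B. \<forall>k t. \<bar>F k t\<bar> \<le> B * (r ^ k * \<NN> z k)" if "r > 0" "z > 0" for r z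
  proof -
    obtain n :: nat where n: "2 / r + 1 / z \<le> real n" using real_arch_simple by blast
    have n': "2 / r \<le> real (Suc n)" "1 / z \<le> real (Suc n)"
    proof -
      have "0 < 2 / r" "0 < 1 / z" using that by auto
      then show "2 / r \<le> real (Suc n)" "1 / z \<le> real (Suc n)" using n by linarith+
    qed
    have r: "2 / real (Suc n) \<le> r" using n'(1) that by (simp add: field_simps)
    have "y n \<le> z" unfolding y_def using n'(2) that by (simp add: field_simps)
    then have N_le: "\<NN> (y n) k \<le> \<NN> z k" for k using N y_pos[of n] by (simp add: weight_matrix_def)
    obtain D where "D \<ge> 0" and D: "\<And>k. partial_prod \<sigma> k \<le> D * partial_prod (\<kappa> n) k"
      using partial_prod_eventually_le[of \<sigma> "\<kappa> n"] \<sigma>(2) \<kappa>_pos \<sigma>_le[of n] by blast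
    have "\<bar>F k t\<bar> \<le> \<bar>B\<bar> * D * (r ^ k * \<NN> z k)" for k t
    proof -
      have "\<bar>F k t\<bar> \<le> B * (2 ^ k * partial_prod \<sigma> k)" by (rule B)
      also have "\<dots> \<le> \<bar>B\<bar> * (2 ^ k * partial_prod \<sigma> k)"
        using partial_prod_pos[of \<sigma> k] \<sigma>(2) by (intro mult_right_mono) (auto simp: less_imp_le)
      also have "\<dots> \<le> \<bar>B\<bar> * (2 ^ k * (D * partial_prod (\<kappa> n) k))"
        using D by (intro mult_left_mono) auto
      also have "\<dots> = \<bar>B\<bar> * D * ((2 / real (Suc n)) ^ k * \<NN> (y n) k)"
        unfolding \<kappa>_def partial_prod_scaled \<nu>(3) by (simp add: power_divide)
      also have "\<dots> \<le> \<bar>B\<bar> * D * (r ^ k * \<NN> z k)"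
        using r N_le \<nu>(4)[of n k] \<open>D \<ge> 0\<close> that(1)
        by (intro mult_left_mono mult_mono power_mono) (auto simp: less_imp_le)
      finally show ?thesis .
    qed
    then show ?thesis by blast
  qed
  with F show thesis by (rule that)
qed

lemma prec_SV_imp_Beurling_inclusion:
  assumes M: "weight_matrix \<MM>" and N: "weight_matrix \<NN>" and ord: "quotient_ordered \<NN>"
    and prec: "\<forall>y>0. \<exists>x>0. \<MM> x \<prec>\<^sub>S\<^sub>V \<NN> y"
  shows "Beurling_sequences \<MM> \<subseteq> borel_map ` Beurling_functions \<NN>"
proof
  fix a assume a: "a \<in> Beurling_sequences \<MM>"
  obtain F :: "nat \<Rightarrow> real \<Rightarrow> real" where F: "derivative_tower F" "\<And>k. F k 0 = Re (a k)"
      "\<And>r y. r > 0 \<Longrightarrow> y > 0 \<Longrightarrow> \<exists>B. \<forall>k t. \<bar>F k t\<bar> \<le> B * (r ^ k * \<NN> y k)"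
    by (rule exists_real_Beurling_tower[OF M N ord prec a abs_Re_le_cmod]) (rule that)
  obtain G :: "nat \<Rightarrow> real \<Rightarrow> real" where G: "derivative_tower G" "\<And>k. G k 0 = Im (a k)"
      "\<And>r y. r > 0 \<Longrightarrow> y > 0 \<Longrightarrow> \<exists>B. \<forall>k t. \<bar>G k t\<bar> \<le> B * (r ^ k * \<NN> y k)"
    by (rule exists_real_Beurling_tower[OF M N ord prec a abs_Im_le_cmod]) (rule that)
  define H where "H k t = complex_of_real (F k t) + \<i> * complex_of_real (G k t)" for k t
  have H: "derivative_tower H"
    unfolding derivative_tower_def
  proof (intro allI)
    fix k t
    have "(F k has_vector_derivative F (Suc k) t) (at t)" "(G k has_vector_derivative G (Suc k) t) (at t)"
      using F(1) G(1) by (simp_all add: derivative_tower_def)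
    then show "(H k has_vector_derivative H (Suc k) t) (at t)"
      unfolding H_def[abs_def]
      by (intro has_vector_derivative_add has_vector_derivative_mult_right
          bounded_linear.has_vector_derivative[OF bounded_linear_of_real])
  qed
  have H_0: "H k 0 = a k" for k by (simp add: H_def F(2) G(2) complex_eq_iff)
  have "bdd_above ((\<lambda>(t, k). norm (nth_deriv k (H 0) t) / (r ^ k * \<NN> y k)) ` (K \<times> UNIV))"
    if ry: "r > 0" "y > 0" for K r y
  proof -
    obtain B1 where B1: "\<And>k t. \<bar>F k t\<bar> \<le> B1 * (r ^ k * \<NN> y k)" using F(3)[OF ry] by blast
    obtain B2 where B2: "\<And>k t. \<bar>G k t\<bar> \<le> B2 * (r ^ k * \<NN> y k)" using G(3)[OF ry] by blast
    have "norm (H k t) / (r ^ k * \<NN> y k) \<le> B1 + B2" for k t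
    proof -
      have w: "0 < r ^ k * \<NN> y k"
        using N that weight_sequence_quotients(4)[of "\<NN> y"] by (simp add: weight_matrix_def)
      have "norm (H k t) \<le> \<bar>F k t\<bar> + \<bar>G k t\<bar>"
        unfolding H_def by (rule order_trans[OF norm_triangle_ineq]) (simp add: norm_mult)
      also have "\<dots> \<le> (B1 + B2) * (r ^ k * \<NN> y k)"
        unfolding distrib_right by (rule add_mono[OF B1 B2])
      finally show ?thesis by (simp only: pos_divide_le_eq[OF w])
    qed
    then show ?thesis
      unfolding nth_deriv_derivative_tower[OF H] by (intro bdd_aboveI2[of _ _ "B1 + B2"]) auto
  qed
  then have "H 0 \<in> Beurling_functions \<NN>"
    unfolding Beurling_functions_def mem_Collect_eq
    by (intro conjI allI impI smooth_derivative_tower[OF H])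
  moreover have "borel_map (H 0) = a"
    unfolding borel_map_def nth_deriv_derivative_tower[OF H] H_0 ..
  ultimately show "a \<in> borel_map ` Beurling_functions \<NN>" by blast
qed

section \<open>The characterization\<close>

theorem theorem3p1:
  fixes \<MM> \<NN> :: "real \<Rightarrow> nat \<Rightarrow> real"
  assumes "weight_matrix \<MM>" and "weight_matrix \<NN>"
    and "quotient_ordered \<MM>" and "quotient_ordered \<NN>"
  shows "Beurling_sequences \<MM> \<subseteq> borel_map ` Beurling_functions \<NN> \<longleftrightarrow>
         (\<forall>y>0. \<exists>x>0. \<MM> x \<prec>\<^sub>S\<^sub>V \<NN> y)"
  using Beurling_inclusion_imp_prec_SV[OF assms(1,2)]
    prec_SV_imp_Beurling_inclusion[OF assms(1,2,4)] by blast

end
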